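(* Let $N\ge3$ and let $D\subset\mathbb{R}^N$ be a bounded domain with $0\in D$ and boundary $\partial D$ of class $C^{2,\alpha}$ for some $0<\alpha<1$. Let $\sigma_+,\sigma_-$ be positive constants with $\sigma_+\neq\sigma_-$ and set $\sigma(x)=\sigma_+$ for $x\in D$, $\sigma(x)=\sigma_-$ for $x\in\mathbb{R}^N\setminus D$. Let $\psi\in C^2(\bar D)\cap C(\mathbb{R}^N)$ satisfy: $\max\psi>0$, $\psi$ is radially symmetric with respect to the origin, and $\overline{\{x\in\mathbb{R}^N:\psi(x)>0\}}\subset D$. Let $u\in C^{1,1}(\bar D)\cap C^{0,1}(\mathbb{R}^N)$ be the solution of $$\min\{-\operatorname{div}(\sigma\nabla u),\,u-\psi\}=0\text{ in }\mathbb{R}^N,\qquad u(x)\to0\text{ as }|x|\to\infty,$$ and suppose that in addition $u=d$ on $\partial D$ for some constant $d>0$. Then $u$ is radially symmetric with respect to the origin and $D$ is a ball centered at the origin.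
   Context: The obstacle problem $\min\{-\operatorname{div}(\sigma\nabla u),u-\psi\}=0$ in $\mathbb{R}^N$ is understood as: $u\ge\psi$ in $\mathbb{R}^N$, $-\operatorname{div}(\sigma\nabla u)\ge0$ in the weak (distributional) sense in $\mathbb{R}^N$, and $-\operatorname{div}(\sigma\nabla u)=0$ in the weak sense in the open set $\{u>\psi\}$. *)

theory Defs
  imports "HOL-Analysis.Analysis"
begin

text \<open>C-infinity on an open set: Frechet differentiable, and every directional derivative
  is again C-infinity (greatest fixed point, i.e. all iterated derivatives exist).\<close>
coinductive smooth_on :: "'a::euclidean_space set \<Rightarrow> ('a \<Rightarrow> real) \<Rightarrow> bool" where
  "open S \<Longrightarrow> f differentiable_on S \<Longrightarrow>
   (\<forall>v. smooth_on S (\<lambda>x. frechet_derivative f (at x) v)) \<Longrightarrow> smooth_on S f"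

definition grad :: "('a::euclidean_space \<Rightarrow> real) \<Rightarrow> 'a \<Rightarrow> 'a" where
  "grad f x = (\<Sum>b\<in>Basis. frechet_derivative f (at x) b *\<^sub>R b)"

definition tsupport :: "('a::euclidean_space \<Rightarrow> real) \<Rightarrow> 'a set" where
  "tsupport f = closure {x. f x \<noteq> 0}"

definition test_fun :: "('a::euclidean_space \<Rightarrow> real) \<Rightarrow> bool" where
  "test_fun \<phi> \<longleftrightarrow> smooth_on UNIV \<phi> \<and> compact (tsupport \<phi>)"

definition C2alpha_on :: "'a::euclidean_space set \<Rightarrow> real \<Rightarrow> ('a \<Rightarrow> real) \<Rightarrow> bool" where
  "C2alpha_on U \<alpha> f \<longleftrightarrow> (\<exists>f' :: 'a \<Rightarrow> ('a \<Rightarrow>\<^sub>L real). \<exists>f'' :: 'a \<Rightarrow> ('a \<Rightarrow>\<^sub>L ('a \<Rightarrow>\<^sub>L real)).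
     (\<forall>x\<in>U. (f has_derivative blinfun_apply (f' x)) (at x)) \<and>
     (\<forall>x\<in>U. (f' has_derivative blinfun_apply (f'' x)) (at x)) \<and>
     continuous_on U f'' \<and>
     (\<exists>C. \<forall>x\<in>U. \<forall>y\<in>U. norm (f'' x - f'' y) \<le> C * dist x y powr \<alpha>))"

definition C2_closure :: "'a::euclidean_space set \<Rightarrow> ('a \<Rightarrow> real) \<Rightarrow> bool" where
  "C2_closure D f \<longleftrightarrow> (\<exists>f' :: 'a \<Rightarrow> ('a \<Rightarrow>\<^sub>L real). \<exists>f'' :: 'a \<Rightarrow> ('a \<Rightarrow>\<^sub>L ('a \<Rightarrow>\<^sub>L real)).
     (\<forall>x\<in>closure D. (f has_derivative blinfun_apply (f' x)) (at x within closure D)) \<and>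
     (\<forall>x\<in>closure D. (f' has_derivative blinfun_apply (f'' x)) (at x within closure D)) \<and>
     continuous_on (closure D) f'')"

definition C11_closure :: "'a::euclidean_space set \<Rightarrow> ('a \<Rightarrow> real) \<Rightarrow> bool" where
  "C11_closure D f \<longleftrightarrow> (\<exists>f' :: 'a \<Rightarrow> ('a \<Rightarrow>\<^sub>L real).
     (\<forall>x\<in>closure D. (f has_derivative blinfun_apply (f' x)) (at x within closure D)) \<and>
     (\<exists>L. \<forall>x\<in>closure D. \<forall>y\<in>closure D. norm (f' x - f' y) \<le> L * dist x y))"

text \<open>Boundary of class C^{2,alpha}: near each boundary point p, after choosing a unit
  direction e, D is the subgraph {x . x.e < h(x')} with x' the projection of x onto the
  hyperplane orthogonal to e, h a C^{2,alpha} function of x' (extended to be constant in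
  direction e).\<close>
definition C2alpha_boundary :: "'a::euclidean_space set \<Rightarrow> real \<Rightarrow> bool" where
  "C2alpha_boundary D \<alpha> \<longleftrightarrow> (\<forall>p\<in>frontier D. \<exists>r>0. \<exists>e h.
     norm e = 1 \<and>
     (\<forall>x. h x = h (x - (x \<bullet> e) *\<^sub>R e)) \<and>
     C2alpha_on (ball p r) \<alpha> h \<and>
     D \<inter> ball p r = {x \<in> ball p r. x \<bullet> e < h x})"

definition weak_grad :: "('a::euclidean_space \<Rightarrow> real) \<Rightarrow> ('a \<Rightarrow> 'a) \<Rightarrow> bool" where
  "weak_grad u g \<longleftrightarrow> g \<in> borel_measurable lebesgue \<and>
     (\<forall>K. compact K \<longrightarrow> set_integrable lebesgue K g) \<and>
     (\<forall>\<phi>. test_fun \<phi> \<longrightarrow>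
        integral\<^sup>L lebesgue (\<lambda>x. u x *\<^sub>R grad \<phi> x) = - integral\<^sup>L lebesgue (\<lambda>x. \<phi> x *\<^sub>R g x))"

text \<open>min{-div(sigma grad u), u - psi} = 0 in the whole space, in the weak sense.\<close>
definition obstacle_solution ::
    "('a::euclidean_space \<Rightarrow> real) \<Rightarrow> ('a \<Rightarrow> real) \<Rightarrow> ('a \<Rightarrow> real) \<Rightarrow> bool" where
  "obstacle_solution \<sigma> \<psi> u \<longleftrightarrow>
     (\<forall>x. u x \<ge> \<psi> x) \<and>
     (\<exists>g. weak_grad u g \<and>
        (\<forall>\<phi>. test_fun \<phi> \<and> (\<forall>x. \<phi> x \<ge> 0) \<longrightarrow>
           integral\<^sup>L lebesgue (\<lambda>x. \<sigma> x * (g x \<bullet> grad \<phi> x)) \<ge> 0) \<and>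
        (\<forall>\<phi>. test_fun \<phi> \<and> tsupport \<phi> \<subseteq> {x. u x > \<psi> x} \<longrightarrow>
           integral\<^sup>L lebesgue (\<lambda>x. \<sigma> x * (g x \<bullet> grad \<phi> x)) = 0))"

end

theory Submission
  imports Defs
begin

text \<open>
  Since \<open>u = d\<close> on the boundary of \<open>D\<close>, the function \<open>v\<close> equal to \<open>\<sigma>\<^sub>+ u - (\<sigma>\<^sub>+ - \<sigma>\<^sub>-) d\<close> in \<open>D\<close> and to \<open>\<sigma>\<^sub>- u\<close> outside is
  continuous and satisfies \<open>\<nabla>v = \<sigma> \<nabla>u\<close> weakly. So \<open>v\<close> is superharmonic in the whole space, tends to
  \<open>0\<close> at infinity, and is harmonic off the contact set \<open>{u = \<psi>}\<close>, which is a compact subset of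
  \<open>{\<psi> > 0}\<close>. There \<open>v\<close> touches a radial obstacle, and such a \<open>v\<close> lies below every rotation of itself
  by comparison; hence \<open>v\<close> is radial, and nonincreasing in \<open>\<bar>x\<bar>\<close>.

  If the least and greatest norms \<open>a\<close>, \<open>b\<close> of boundary points of \<open>D\<close> were different, then \<open>v\<close> would
  equal \<open>\<sigma>\<^sub>- d\<close> for \<open>a \<le> \<bar>x\<bar> \<le> b\<close>. But the contact set is radial and contained in \<open>D\<close>, so it
  avoids \<open>\<bar>x\<bar> > r\<close> for some \<open>r < b\<close>, and comparison with a multiple of \<open>\<bar>x\<bar>\<^sup>2\<^sup>-\<^sup>N\<close> makes \<open>v\<close> smaller than
  \<open>\<sigma>\<^sub>- d\<close> at \<open>\<bar>x\<bar> = b\<close>.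
\<close>

subsection \<open>Smooth bumps\<close>

text \<open>The comparison with rotations hinges on the contact set lying in \<open>D\<close>, where
  \<open>v\<close> is an increasing affine function of \<open>u\<close>. Inside \<open>D\<close> the
  minimum principle gives u \<ge> d > 0. Outside, a positive multiple of the fundamental solution,
  which vanishes at infinity because N \<ge> 3, lies below \<open>v\<close> and forces u > 0 \<ge>
  \<psi>. So a contact point x has \<psi>(x) > 0, and for a rotation R also \<psi>(R x) > 0, whence
  R x is in \<open>D\<close>. Then u(R x) \<ge> \<psi>(R x) = u(x) gives v(R x) \<ge> v(x).
  Consequently the set where v(R x) < v(x) contains no contact point, and there v(R x) - v(x) is
  superharmonic.

  The equation is only weak, and \<open>v\<close> is merely Lipschitz across the boundary of
  \<open>D\<close>, so pointwise second derivatives cannot be compared directly. Everything is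
  reduced to mollification with one explicit radial bump, whose Laplacian has a closed form. The
  Lipschitz constant controls the mollification error as well as the boundary layer of
  \<open>D\<close>. Subtracting a multiple of \<open>d\<close> inside \<open>D\<close> removes the
  jump of \<sigma> u, which would otherwise produce a surface term.\<close>

definition flat :: "nat \<Rightarrow> real \<Rightarrow> real" where
  "flat k t = (if t > 0 then exp (- 1 / t) / t ^ k else 0)"

text \<open>The powers of \<open>1 / t\<close> close the family under differentiation;
  \<open>flat 0\<close> is the classical flat function \<open>exp (- 1 / t)\<close>. At
  \<open>t = 0\<close> the right difference quotient is \<open>s ^ (k+1) / exp s\<close> with
  \<open>s = 1 / t\<close> tending to infinity.\<close>

lemma flat_has_deriv: "(flat k has_real_derivative (flat (k+2) t - real k * flat (k+1) t)) (at t)"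
proof -
  consider "t > 0" | "t < 0" | "t = 0" by linarith
  then show ?thesis
  proof cases
    case 1
    have "((\<lambda>t. exp (- 1 / t) / t ^ k) has_real_derivative (flat (k+2) t - real k * flat (k+1) t)) (at t)"
      using 1 by (auto intro!: derivative_eq_intros simp: flat_def)
        (cases k, auto simp: field_simps power2_eq_square)
    then show ?thesis
      by (rule has_field_derivative_transform_within_open[where S="{0<..}"]) (use 1 in \<open>auto simp: flat_def\<close>)
  next
    case 2
    have "((\<lambda>t. 0) has_real_derivative (flat (k+2) t - real k * flat (k+1) t)) (at t)"
      using 2 by (auto simp: flat_def)
    then show ?thesis
      by (rule has_field_derivative_transform_within_open[where S="{..<0}"]) (use 2 in \<open>auto simp: flat_def\<close>)
  next
    case 3
    have l: "((\<lambda>t. exp (- 1 / t) / t ^ (k+1)) \<longlongrightarrow> 0) (at_right (0::real))"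
    proof -
      have "((\<lambda>s. s ^ (k+1) / exp s) \<longlongrightarrow> 0) (at_top::real filter)" by (rule tendsto_power_div_exp_0)
      then have "((\<lambda>t. (inverse t) ^ (k+1) / exp (inverse t)) \<longlongrightarrow> 0) (at_right (0::real))"
        using filterlim_inverse_at_top_right filterlim_compose by blast
      then show ?thesis
        by (simp add: field_simps exp_minus inverse_eq_divide power_divide)
    qed
    have r: "((\<lambda>h. flat k h / h) \<longlongrightarrow> 0) (at_right 0)"
      using l by (rule Lim_transform_eventually)
        (auto simp: eventually_at_right_less flat_def eventually_at_filter)
    have "((\<lambda>h. flat k h / h) \<longlongrightarrow> 0) (at_left 0)"
      by (rule tendsto_eventually) (auto simp: flat_def eventually_at_filter)
    with r have "((\<lambda>h. flat k h / h) \<longlongrightarrow> 0) (at 0)"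
      by (simp add: filterlim_split_at)
    then show ?thesis using 3 by (simp add: DERIV_def flat_def)
  qed
qed

text \<open>The profile is composed with the squared distance, a polynomial in \<open>y\<close>, so
  the centre is not a singular point. The mollifier is \<open>bump 0\<close>; higher
  \<open>k\<close> arise from differentiating it.\<close>

definition bump :: "nat \<Rightarrow> real \<Rightarrow> 'a::euclidean_space \<Rightarrow> 'a \<Rightarrow> real" where
  "bump k e x y = flat k (1 - ((y - x) \<bullet> (y - x)) / e\<^sup>2)"

lemma bump_has_derivative:
  "(bump k e x has_derivative (\<lambda>h. (bump (k+2) e x y - real k * bump (k+1) e x y) * (- 2 / e\<^sup>2 * ((y - x) \<bullet> h)))) (at y)"
proof -
  have 1: "((\<lambda>y. 1 - ((y - x) \<bullet> (y - x)) / e\<^sup>2) has_derivative (\<lambda>h. - 2 / e\<^sup>2 * ((y - x) \<bullet> h))) (at y)"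
  proof -
    have "((\<lambda>y. (y - x) \<bullet> (y - x)) has_derivative (\<lambda>h. 2 * ((y - x) \<bullet> h))) (at y)"
      by (auto intro!: derivative_eq_intros ext simp: inner_commute)
    from has_derivative_diff[OF has_derivative_const[of 1] has_derivative_mult_right[OF this, of "1 / e\<^sup>2"]]
    show ?thesis by (simp add: mult.assoc)
  qed
  have 2: "(flat k has_derivative (*) (flat (k+2) t - real k * flat (k+1) t)) (at t)" for t
    using flat_has_deriv[of k t] by (simp add: has_field_derivative_def)
  show ?thesis
    unfolding bump_def[abs_def]
    using has_derivative_compose[OF 1 2] by simp
qed

lemma frechet_derivative_bump:
  "frechet_derivative (bump k e x) (at y) = (\<lambda>h. (bump (k+2) e x y - real k * bump (k+1) e x y) * (- 2 / e\<^sup>2 * ((y - x) \<bullet> h)))"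
  using bump_has_derivative frechet_derivative_at by metis

text \<open>Coinduction for \<^const>\<open>smooth_on\<close> needs a class closed under directional derivatives; the
  product rule forces closure under sums and products.\<close>

inductive smooth_gen :: "('a::euclidean_space \<Rightarrow> real) \<Rightarrow> bool" where
  smooth: "smooth_on UNIV f \<Longrightarrow> smooth_gen f"
| bump: "smooth_gen (bump k e x)"
| const: "smooth_gen (\<lambda>y. c)"
| inner: "smooth_gen (\<lambda>y. y \<bullet> v)"
| add: "smooth_gen f \<Longrightarrow> smooth_gen g \<Longrightarrow> smooth_gen (\<lambda>y. f y + g y)"
| mult: "smooth_gen f \<Longrightarrow> smooth_gen g \<Longrightarrow> smooth_gen (\<lambda>y. f y * g y)"

lemma smooth_gen_deriv: "smooth_gen f \<Longrightarrow> (\<forall>x. f differentiable (at x)) \<and> (\<forall>v. smooth_gen (\<lambda>x. frechet_derivative f (at x) v))"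
proof (induction rule: smooth_gen.induct)
  case (smooth f)
  then show ?case by cases (auto simp: differentiable_on_def intro: smooth_gen.smooth)
next
  case (bump k e x)
  have "smooth_gen (\<lambda>y. (bump (k+2) e x y + (- real k) * bump (k+1) e x y) * (- 2 / e\<^sup>2 * (y \<bullet> v + (- (x \<bullet> v)))))" for v
    by (intro smooth_gen.intros)
  then show ?case
    using bump_has_derivative[of k e x] unfolding frechet_derivative_bump
    by (auto simp: differentiable_def inner_diff_left)
next
  case (const c)
  then show ?case by (auto intro: smooth_gen.const)
next
  case (inner v)
  have d: "((\<lambda>y. y \<bullet> v) has_derivative (\<lambda>h. h \<bullet> v)) (at x)" for x
    by (auto intro!: derivative_eq_intros)
  have "frechet_derivative (\<lambda>y. y \<bullet> v) (at x) = (\<lambda>h. h \<bullet> v)" for x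
    using frechet_derivative_at[OF d] by simp
  then show ?case using d by (auto simp: differentiable_def intro: smooth_gen.const)
next
  case (add f g)
  have "frechet_derivative (\<lambda>y. f y + g y) (at x) = (\<lambda>v. frechet_derivative f (at x) v + frechet_derivative g (at x) v)" for x
    by (rule frechet_derivative_at[symmetric])
      (use add in \<open>auto intro!: derivative_eq_intros simp: frechet_derivative_works[THEN iffD1]\<close>)
  then show ?case using add by (auto intro: smooth_gen.add)
next
  case (mult f g)
  have "frechet_derivative (\<lambda>y. f y * g y) (at x) = (\<lambda>v. f x * frechet_derivative g (at x) v + frechet_derivative f (at x) v * g x)" for x
    by (rule frechet_derivative_at[symmetric])
      (use mult in \<open>auto intro!: derivative_eq_intros simp: frechet_derivative_works[THEN iffD1]\<close>)
  then show ?case using mult by (auto intro!: smooth_gen.add smooth_gen.mult)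
qed

lemma smooth_gen_smooth: "smooth_gen f \<Longrightarrow> smooth_on UNIV f"
proof (coinduction arbitrary: f)
  case smooth_on
  then show ?case using smooth_gen_deriv[OF smooth_on] 
    by (auto simp: differentiable_on_def)
qed

subsection \<open>Test functions and convolution\<close>

abbreviation dderiv :: "('a::euclidean_space \<Rightarrow> real) \<Rightarrow> 'a \<Rightarrow> 'a \<Rightarrow> real" where
  "dderiv f v \<equiv> (\<lambda>x. frechet_derivative f (at x) v)"

lemma smooth_has_derivative: "smooth_on UNIV f \<Longrightarrow> (f has_derivative (\<lambda>v. dderiv f v x)) (at x)"
  using smooth_gen_deriv[OF smooth_gen.smooth, of f] frechet_derivative_works[of f] by simp

lemma smooth_dderiv: "smooth_on UNIV f \<Longrightarrow> smooth_on UNIV (dderiv f v)"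
  using smooth_gen_deriv[OF smooth_gen.smooth, of f] by (intro smooth_gen_smooth) simp

lemma dderiv_eqI: "(f has_derivative f') (at x) \<Longrightarrow> dderiv f v x = f' v"
  using frechet_derivative_at[of f f' x] by simp

lemma smooth_continuous:
  assumes "smooth_on UNIV f" shows "continuous_on A f"
proof (rule continuous_at_imp_continuous_on, rule ballI)
  show "isCont f x" for x
    by (rule has_derivative_continuous[OF smooth_has_derivative[OF assms]])
qed

lemma smooth_mult: "smooth_on UNIV f \<Longrightarrow> smooth_on UNIV g \<Longrightarrow> smooth_on UNIV (\<lambda>x. f x * g x)"
  by (rule smooth_gen_smooth[OF smooth_gen.mult[OF smooth_gen.smooth smooth_gen.smooth]])

lemma dderiv_mult:
  assumes "smooth_on UNIV f" "smooth_on UNIV g"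
  shows "dderiv (\<lambda>x. f x * g x) v x = f x * dderiv g v x + dderiv f v x * g x"
proof -
  have "((\<lambda>x. f x * g x) has_derivative (\<lambda>v. f x * dderiv g v x + dderiv f v x * g x)) (at x)"
    using has_derivative_mult[OF smooth_has_derivative[OF assms(1)] smooth_has_derivative[OF assms(2)]] by simp
  from dderiv_eqI[OF this] show ?thesis .
qed

lemma dderiv_expand:
  assumes "smooth_on UNIV f"
  shows "dderiv f h x = (\<Sum>b\<in>Basis. (h \<bullet> b) * dderiv f b x)"
proof -
  interpret bounded_linear "\<lambda>v. dderiv f v x"
    using smooth_has_derivative[OF assms] by (rule has_derivative_bounded_linear)
  have "dderiv f h x = dderiv f (\<Sum>b\<in>Basis. (h \<bullet> b) *\<^sub>R b) x"
    by (simp add: euclidean_representation)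
  also have "\<dots> = (\<Sum>b\<in>Basis. (h \<bullet> b) * dderiv f b x)"
    by (simp add: sum scaleR)
  finally show ?thesis .
qed

lemma zero_off_tsupport: "f x \<noteq> 0 \<Longrightarrow> x \<in> tsupport f"
  unfolding tsupport_def by (rule subsetD[OF closure_subset]) simp

lemma dderiv_zero_off_tsupport:
  assumes "x \<notin> tsupport f"
  shows "dderiv f v x = 0"
proof -
  have "open (- tsupport f)" unfolding tsupport_def by (intro open_Compl closed_closure)
  have "((\<lambda>x. 0::real) has_derivative (\<lambda>v. 0)) (at x)" by simp
  then have "(f has_derivative (\<lambda>v. 0)) (at x)"
    by (rule has_derivative_transform_within_open[OF _ \<open>open (- tsupport f)\<close>])
      (use assms zero_off_tsupport in force)+
  from dderiv_eqI[OF this] show ?thesis .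
qed

lemma tsupport_subset: "closed K \<Longrightarrow> (\<And>x. x \<notin> K \<Longrightarrow> f x = 0) \<Longrightarrow> tsupport f \<subseteq> K"
  unfolding tsupport_def by (rule closure_minimal) auto

lemma tsupport_dderiv: "tsupport (dderiv f v) \<subseteq> tsupport f"
  by (rule tsupport_subset) (auto simp: dderiv_zero_off_tsupport, simp add: tsupport_def)

lemma compact_tsupport_subset: "tsupport f \<subseteq> K \<Longrightarrow> compact K \<Longrightarrow> compact (tsupport f)"
  by (metis closed_closure compact_Int_closed inf.absorb2 tsupport_def)

lemma test_fun_dderiv: "test_fun f \<Longrightarrow> test_fun (dderiv f v)"
  unfolding test_fun_def by (metis smooth_dderiv compact_tsupport_subset[OF tsupport_dderiv])

lemma test_fun_mult:
  assumes "smooth_on UNIV f" "test_fun g"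
  shows "test_fun (\<lambda>x. f x * g x)"
proof -
  have *: "tsupport (\<lambda>x. f x * g x) \<subseteq> tsupport g"
    by (rule tsupport_subset) (auto simp: tsupport_def[of g] intro: zero_off_tsupport[of g, unfolded tsupport_def])
  then show "test_fun (\<lambda>x. f x * g x)"
    using smooth_mult[OF assms(1)] assms(2) compact_tsupport_subset[OF *] unfolding test_fun_def by blast
qed

lemma test_fun_support:
  assumes "test_fun f"
  obtains R where "R > 0" "\<And>x. f x \<noteq> 0 \<Longrightarrow> norm x \<le> R"  "\<And>x v. dderiv f v x \<noteq> 0 \<Longrightarrow> norm x \<le> R"
proof -
  have "bounded (tsupport f)" using assms by (simp add: test_fun_def compact_imp_bounded)
  then obtain R where R: "R > 0" "\<And>x. x \<in> tsupport f \<Longrightarrow> norm x \<le> R" unfolding bounded_pos by blast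
  show ?thesis
    using that[of R] R zero_off_tsupport dderiv_zero_off_tsupport by metis
qed

lemma uniformly_continuous_compact_support:
  fixes g :: "'a::euclidean_space \<Rightarrow> real"
  assumes "continuous_on UNIV g" "\<And>x. g x \<noteq> 0 \<Longrightarrow> norm x \<le> R"
  shows "uniformly_continuous_on UNIV g"
proof -
  have "uniformly_continuous_on (cball 0 (R+1)) g"
    by (rule compact_uniformly_continuous) (auto intro: continuous_on_subset[OF assms(1)])
  show ?thesis unfolding uniformly_continuous_on_def
  proof (intro allI impI)
    fix e :: real assume "e > 0"
    then obtain d where d: "d > 0" "\<And>x x'. x \<in> cball 0 (R+1) \<Longrightarrow> x' \<in> cball 0 (R+1) \<Longrightarrow> dist x' x < d \<Longrightarrow> dist (g x') (g x) < e"
      using \<open>uniformly_continuous_on (cball 0 (R+1)) g\<close> unfolding uniformly_continuous_on_def by metis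
    \<comment> \<open>Capping the distance at \<open>1\<close> puts both points into
      \<open>cball 0 (R+1)\<close> as soon as one of them has norm at most \<open>R\<close>.\<close>
    have "dist (g x') (g x) < e" if x: "dist x' x < min d 1" for x x'
    proof (cases "norm x \<le> R \<or> norm x' \<le> R")
      case True
      have "norm x \<le> norm x' + dist x' x" "norm x' \<le> norm x + dist x' x"
        by (smt (verit) dist_norm norm_triangle_sub dist_commute)+
      then show ?thesis using True x by (intro d) auto
    next
      case False
      then have "g x = 0" "g x' = 0" using assms(2) by blast+
      then show ?thesis using \<open>e > 0\<close> by simp
    qed
    then show "\<exists>d>0. \<forall>x\<in>UNIV. \<forall>x'\<in>UNIV. dist x' x < d \<longrightarrow> dist (g x') (g x) < e"
      using d(1) by (intro exI[of _ "min d 1"]) auto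
  qed
qed

text \<open>Uniformity in \<open>z\<close> is what allows differentiation under the integral sign
  against a merely locally integrable function. It comes from the mean value theorem on the segment
  from \<open>z\<close> to \<open>z + h\<close> and the uniform continuity of the finitely many
  partial derivatives.\<close>

lemma test_fun_uniform_differentiable:
  assumes f: "test_fun f" and "e > 0"
  obtains d where "d > 0" "\<And>z h. norm h < d \<Longrightarrow> \<bar>f (z + h) - f z - dderiv f h z\<bar> \<le> e * norm h"
proof -
  have sf: "smooth_on UNIV f" using f by (simp add: test_fun_def)
  \<comment> \<open>The error is shared equally among the coordinate directions.\<close>
  define e' where "e' = e / DIM('a)"
  have e': "e' > 0" using \<open>e > 0\<close> by (simp add: e'_def)
  have "\<forall>b\<in>(Basis::'a set). \<exists>d>0. \<forall>x x'. dist x' x < d \<longrightarrow> dist (dderiv f b x') (dderiv f b x) < e'"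
  proof
    fix b :: 'a assume "b \<in> Basis"
    obtain R where "\<And>x v. dderiv f v x \<noteq> 0 \<Longrightarrow> norm x \<le> R" using test_fun_support[OF f] by metis
    then have "uniformly_continuous_on UNIV (dderiv f b)"
      using uniformly_continuous_compact_support smooth_continuous[OF smooth_dderiv[OF sf]] by blast
    then show "\<exists>d>0. \<forall>x x'. dist x' x < d \<longrightarrow> dist (dderiv f b x') (dderiv f b x) < e'"
      using e' unfolding uniformly_continuous_on_def by auto
  qed
  then obtain D where D: "\<And>b. b \<in> Basis \<Longrightarrow> D b > 0"
    "\<And>b x x'. b \<in> (Basis::'a set) \<Longrightarrow> dist x' x < D b \<Longrightarrow> dist (dderiv f b x') (dderiv f b x) < e'"
    by metis
  define d where "d = Min (D ` (Basis::'a set))"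
  have d: "d > 0" "\<And>b. b \<in> Basis \<Longrightarrow> d \<le> D b" unfolding d_def using D(1) by auto
  have "\<bar>f (z + h) - f z - dderiv f h z\<bar> \<le> e * norm h" if h: "norm h < d" for z h
  proof -
    have "((\<lambda>t. f (z + t *\<^sub>R h)) has_derivative (\<lambda>s. s * dderiv f h (z + t *\<^sub>R h))) (at t within {0..1})" for t
    proof -
      have 1: "((\<lambda>t. z + t *\<^sub>R h) has_derivative (\<lambda>s. s *\<^sub>R h)) (at t within {0..1})"
        by (auto intro!: derivative_eq_intros)
      have "dderiv f (s *\<^sub>R h) x = s * dderiv f h x" for s x
        using has_derivative_bounded_linear[OF smooth_has_derivative[OF sf]] 
        by (metis linear_simps(5) real_scaleR_def)
      with has_derivative_compose[OF 1 smooth_has_derivative[OF sf]] show ?thesis by simp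
    qed
    from mvt_simple[of 0 1, OF _ this] obtain t where t: "t \<in> {0<..<1}"
      "f (z + h) - f z = dderiv f h (z + t *\<^sub>R h)" by auto
    have "f (z + h) - f z - dderiv f h z = (\<Sum>b\<in>Basis. (h \<bullet> b) * (dderiv f b (z + t *\<^sub>R h) - dderiv f b z))"
      unfolding t(2) dderiv_expand[OF sf, where h=h] by (simp add: sum_subtractf algebra_simps)
    also have "\<bar>\<dots>\<bar> \<le> (\<Sum>b\<in>(Basis::'a set). norm h * e')"
    proof (rule order_trans[OF sum_abs sum_mono])
      fix b :: 'a assume b: "b \<in> Basis"
      have "norm (t *\<^sub>R h) \<le> 1 * norm h"
        unfolding norm_scaleR by (rule mult_right_mono) (use t in auto)
      then have "dist (z + t *\<^sub>R h) z < D b" using h d(2)[OF b] by (simp add: dist_norm)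
      from D(2)[OF b this] have "\<bar>dderiv f b (z + t *\<^sub>R h) - dderiv f b z\<bar> \<le> e'" by (simp add: dist_real_def)
      then show "\<bar>(h \<bullet> b) * (dderiv f b (z + t *\<^sub>R h) - dderiv f b z)\<bar> \<le> norm h * e'"
        unfolding abs_mult using Basis_le_norm[OF b] by (intro mult_mono) auto
    qed
    also have "\<dots> = e * norm h" by (simp add: e'_def)
    finally show ?thesis .
  qed
  with d(1) that show ?thesis by blast
qed

section \<open>Local integrability and convolution with test functions\<close>

definition locally_integrable :: "('a::euclidean_space \<Rightarrow> real) \<Rightarrow> bool" where
  "locally_integrable w \<longleftrightarrow> (\<forall>K. compact K \<longrightarrow> set_integrable lebesgue K w)"

lemma continuous_locally_integrable: "continuous_on UNIV w \<Longrightarrow> locally_integrable w"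
  unfolding locally_integrable_def set_integrable_def
  using borel_integrable_compact[of _ w] 
  by (auto simp: scaleR_conv_of_real continuous_on_subset integrable_completion intro!: integrable_completion[THEN iffD2])

lemma locally_integrable_indicator:
  assumes "A \<in> sets lebesgue" shows "locally_integrable (indicator A)"
  unfolding locally_integrable_def set_integrable_def
proof (intro allI impI)
  fix K :: "'a set" assume "compact K"
  then have "K \<inter> A \<in> lmeasurable"
    using assms by (intro fmeasurable_Int_fmeasurable lmeasurable_compact)
  then have "integrable lebesgue (indicat_real (K \<inter> A))"
    by (intro integrable_real_indicator) (auto simp: fmeasurable_def)
  then show "integrable lebesgue (\<lambda>x. indicator K x *\<^sub>R indicat_real A x)"
    by (rule back_subst[where P="integrable lebesgue"]) (auto simp: indicator_def)
qed

lemma integrable_locally_integrable_mult: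
  assumes w: "locally_integrable w" and g: "continuous_on UNIV g" and R: "\<And>x. g x \<noteq> 0 \<Longrightarrow> norm x \<le> R"
  shows "integrable lebesgue (\<lambda>x. w x * g x)"
proof -
  have "compact (g ` cball 0 R)"
    by (intro compact_continuous_image continuous_on_subset[OF g]) auto
  then obtain B where B: "\<And>x. x \<in> cball 0 R \<Longrightarrow> \<bar>g x\<bar> \<le> B"
    by (metis (mono_tags, lifting) bounded_real compact_imp_bounded image_eqI)
  have i: "integrable lebesgue (\<lambda>x. indicator (cball 0 R) x * w x)"
    using w unfolding locally_integrable_def set_integrable_def by simp
  have eq: "(\<lambda>x. w x * g x) = (\<lambda>x. (indicator (cball 0 R) x * w x) * g x)"
    using R by (force simp: indicator_def)
  have gm: "g \<in> borel_measurable lebesgue"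
    using g by (intro measurable_completion) (simp add: borel_measurable_continuous_onI)
  show ?thesis unfolding eq
  proof (rule Bochner_Integration.integrable_bound[OF integrable_mult_right[OF i, of B]])
    show "(\<lambda>x. indicator (cball 0 R) x * w x * g x) \<in> borel_measurable lebesgue"
      using borel_measurable_integrable[OF i] gm by measurable
    show "AE x in lebesgue. norm (indicator (cball 0 R) x * w x * g x) \<le> norm (B * (indicator (cball 0 R) x * w x))"
    proof (rule AE_I2)
      fix x :: 'a
      show "norm (indicator (cball 0 R) x * w x * g x) \<le> norm (B * (indicator (cball 0 R) x * w x))"
        using B[of x] by (cases "x \<in> cball 0 R")
          (auto simp: abs_mult mult.commute[of "\<bar>w x\<bar>"] intro!: mult_right_mono)
    qed
  qed
qed

lemma integrable_conv:
  assumes w: "locally_integrable w" and f: "test_fun f"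
  shows "integrable lebesgue (\<lambda>y. w y * f (x - y))"
proof -
  obtain R where R: "\<And>x. f x \<noteq> 0 \<Longrightarrow> norm x \<le> R" using test_fun_support[OF f] by metis
  have sf: "smooth_on UNIV f" using f by (simp add: test_fun_def)
  show ?thesis
  proof (rule integrable_locally_integrable_mult[OF w])
    show "continuous_on UNIV (\<lambda>y. f (x - y))"
      by (intro continuous_on_compose2[OF smooth_continuous[OF sf]] continuous_intros) auto
    show "norm y \<le> R + norm x" if "f (x - y) \<noteq> 0" for y
      using R[OF that] by (smt (verit) norm_minus_commute norm_triangle_sub)
  qed
qed

text \<open>All derivatives fall on \<open>f\<close>. Its first-order remainder is small uniformly,
  and for small increments it lives in one fixed compact set, on which \<open>w\<close> is
  integrable.\<close>

lemma conv_has_derivative: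
  fixes w f :: "'a::euclidean_space \<Rightarrow> real"
  assumes w: "locally_integrable w" and f: "test_fun f"
  shows "((\<lambda>x. \<integral>y. w y * f (x - y) \<partial>lebesgue) has_derivative (\<lambda>h. \<integral>y. w y * dderiv f h (x - y) \<partial>lebesgue)) (at x)"
  unfolding has_derivative_at_alt
proof (intro conjI allI impI)
  have sf: "smooth_on UNIV f" using f by (simp add: test_fun_def)
  have bl: "bounded_linear (\<lambda>h. dderiv f h z)" for z
    by (rule has_derivative_bounded_linear[OF smooth_has_derivative[OF sf]])
  note int = integrable_conv[OF w f] integrable_conv[OF w test_fun_dderiv[OF f]]
  show "bounded_linear (\<lambda>h. \<integral>y. w y * dderiv f h (x - y) \<partial>lebesgue)"
    unfolding linear_conv_bounded_linear[symmetric]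
  proof (rule linearI)
    fix h k :: 'a and c :: real
    have "(\<lambda>y. w y * dderiv f (h + k) (x - y)) = (\<lambda>y. w y * dderiv f h (x - y) + w y * dderiv f k (x - y))"
      using linear_simps(1)[OF bl] by (simp add: distrib_left)
    then show "(\<integral>y. w y * dderiv f (h + k) (x - y) \<partial>lebesgue) =
      (\<integral>y. w y * dderiv f h (x - y) \<partial>lebesgue) + (\<integral>y. w y * dderiv f k (x - y) \<partial>lebesgue)"
      using int(2) by simp
    have "(\<lambda>y. w y * dderiv f (c *\<^sub>R h) (x - y)) = (\<lambda>y. c * (w y * dderiv f h (x - y)))"
      using linear_simps(5)[OF bl] by (simp add: mult_ac)
    then show "(\<integral>y. w y * dderiv f (c *\<^sub>R h) (x - y) \<partial>lebesgue) = c *\<^sub>R (\<integral>y. w y * dderiv f h (x - y) \<partial>lebesgue)"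
      by simp
  qed
  fix e :: real assume e: "e > 0"
  obtain R where R: "R > 0" "\<And>x. f x \<noteq> 0 \<Longrightarrow> norm x \<le> R" "\<And>x v. dderiv f v x \<noteq> 0 \<Longrightarrow> norm x \<le> R"
    using test_fun_support[OF f] by metis
  \<comment> \<open>The extra \<open>1\<close> absorbs the displacement from \<open>x\<close> to
    \<open>y\<close>, so all three integrands vanish off \<open>K\<close>.\<close>
  define K where "K = cball x (R + 1)"
  have iK: "integrable lebesgue (\<lambda>y. \<bar>indicator K y * w y\<bar>)"
    using w unfolding locally_integrable_def set_integrable_def K_def by simp
  define I where "I = (\<integral>y. \<bar>indicator K y * w y\<bar> \<partial>lebesgue)"
  have I: "I \<ge> 0" by (simp add: I_def)
  \<comment> \<open>\<open>I + 1\<close> instead of \<open>I\<close>, since \<open>w\<close> may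
    vanish on \<open>K\<close>.\<close>
  define e' where "e' = e / (I + 1)"
  have e': "e' > 0" using e I by (simp add: e'_def)
  obtain d where d: "d > 0" "\<And>z h. norm h < d \<Longrightarrow> \<bar>f (z + h) - f z - dderiv f h z\<bar> \<le> e' * norm h"
    using test_fun_uniform_differentiable[OF f e'] by metis
  show "\<exists>d>0. \<forall>y. norm (y - x) < d \<longrightarrow>
     norm ((\<integral>z. w z * f (y - z) \<partial>lebesgue) - (\<integral>z. w z * f (x - z) \<partial>lebesgue) - (\<integral>z. w z * dderiv f (y - x) (x - z) \<partial>lebesgue)) \<le> e * norm (y - x)"
  proof (intro exI conjI allI impI)
    show "min d 1 > 0" using d by simp
    fix y assume y: "norm (y - x) < min d 1"
    define T where "T z = w z * f (y - z) - w z * f (x - z) - w z * dderiv f (y - x) (x - z)" for z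
    have "(\<integral>z. w z * f (y - z) \<partial>lebesgue) - (\<integral>z. w z * f (x - z) \<partial>lebesgue) - (\<integral>z. w z * dderiv f (y - x) (x - z) \<partial>lebesgue)
      = integral\<^sup>L lebesgue T"
      unfolding T_def[abs_def] using int by simp
    also have "norm \<dots> \<le> (\<integral>z. e' * norm (y - x) * \<bar>indicator K z * w z\<bar> \<partial>lebesgue)"
    proof (rule order_trans[OF integral_norm_bound integral_mono[OF integrable_norm]])
      show "integrable lebesgue T" unfolding T_def[abs_def] using int by simp
      show "integrable lebesgue (\<lambda>z. e' * norm (y - x) * \<bar>indicator K z * w z\<bar>)"
        by (rule integrable_mult_right[OF iK])
      fix z
      have T: "T z = w z * (f ((x - z) + (y - x)) - f (x - z) - dderiv f (y - x) (x - z))"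
        by (simp add: T_def algebra_simps)
      show "norm (T z) \<le> e' * norm (y - x) * \<bar>indicator K z * w z\<bar>"
      proof (cases "z \<in> K")
        case True
        have "\<bar>T z\<bar> \<le> \<bar>w z\<bar> * (e' * norm (y - x))"
          unfolding T abs_mult by (intro mult_left_mono d) (use y in auto)
        then show ?thesis using True by (simp add: mult_ac)
      next
        case False
        then have "norm (x - z) > R + 1" by (simp add: K_def dist_norm)
        moreover have "norm (y - z) \<ge> norm (x - z) - norm (y - x)"
          using norm_triangle_ineq2[of "x - z" "x - y"] by (simp add: norm_minus_commute)
        ultimately have "f (x - z) = 0" "f (y - z) = 0" "dderiv f (y - x) (x - z) = 0"
          using R y by force+
        then show ?thesis using e' by (simp add: T_def)
      qed
    qed
    also have "\<dots> = e' * I * norm (y - x)" by (simp add: I_def)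
    also have "\<dots> \<le> e * norm (y - x)"
      using e I by (intro mult_right_mono) (auto simp: e'_def field_simps)
    finally show "norm ((\<integral>z. w z * f (y - z) \<partial>lebesgue) - (\<integral>z. w z * f (x - z) \<partial>lebesgue) - (\<integral>z. w z * dderiv f (y - x) (x - z) \<partial>lebesgue)) \<le> e * norm (y - x)" .
  qed
qed

lemma dderiv_conv:
  assumes w: "locally_integrable w" and f: "test_fun f"
  shows "dderiv (\<lambda>x. \<integral>y. w y * f (x - y) \<partial>lebesgue) v x = (\<integral>y. w y * dderiv f v (x - y) \<partial>lebesgue)"
  by (rule dderiv_eqI[OF conv_has_derivative[OF assms]])

text \<open>A directional derivative of a convolution of \<open>w\<close> with a test function is
  again such a convolution, so these functions form a coinduction invariant by themselves.\<close>

lemma smooth_conv: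
  assumes w: "locally_integrable w" and f: "test_fun f"
  shows "smooth_on UNIV (\<lambda>x. \<integral>y. w y * f (x - y) \<partial>lebesgue)"
  using f
proof (coinduction arbitrary: f)
  case smooth_on
  have "(\<lambda>x. \<integral>y. w y * f (x - y) \<partial>lebesgue) differentiable_on UNIV"
    using conv_has_derivative[OF w smooth_on] by (auto simp: differentiable_on_def differentiable_def)
  then show ?case using test_fun_dderiv[OF smooth_on] dderiv_conv[OF w smooth_on] 
    by (auto intro!: exI[of _ "dderiv f _"])
qed

lemma integral_reflect_translate:
  fixes f :: "'a::euclidean_space \<Rightarrow> real"
  assumes "f \<in> borel_measurable borel"
  shows "(\<integral>y. f (x - y) \<partial>lebesgue) = integral\<^sup>L lebesgue f"
proof -
  have "integral\<^sup>L lborel f = (\<integral>y. f (x - y) \<partial>lborel)"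
    by (subst lborel_affine[of "-1" x])
      (use assms in \<open>simp_all add: density_1 integral_distr\<close>)
  moreover have "(\<lambda>y. f (x - y)) \<in> borel_measurable borel" using assms by measurable
  ultimately show ?thesis using assms by (simp add: integral_completion)
qed

text \<open>Convolving \<open>f\<close> with the constant \<open>1\<close> gives a constant by
  translation invariance, and differentiating that constant yields the claim. This stands in for
  integration by parts.\<close>

lemma integral_dderiv_zero:
  assumes f: "test_fun f"
  shows "integral\<^sup>L lebesgue (dderiv f v) = 0"
proof -
  have sf: "smooth_on UNIV f" using f by (simp add: test_fun_def)
  have m: "f \<in> borel_measurable borel" "dderiv f v \<in> borel_measurable borel"
    by (intro borel_measurable_continuous_onI smooth_continuous sf smooth_dderiv)+
  have l: "locally_integrable (\<lambda>_. 1)" by (rule continuous_locally_integrable) simp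
  have "integral\<^sup>L lebesgue (dderiv f v) = (\<integral>y. 1 * dderiv f v (0 - y) \<partial>lebesgue)"
    using integral_reflect_translate[OF m(2), of 0] by simp
  also have "\<dots> = dderiv (\<lambda>x. \<integral>y. 1 * f (x - y) \<partial>lebesgue) v 0"
    by (rule dderiv_conv[OF l f, symmetric])
  also have "\<dots> = 0" using integral_reflect_translate[OF m(1)] by simp
  finally show ?thesis .
qed

subsection \<open>Laplacian of bumps and cutoff functions\<close>

definition laplacian :: "('a::euclidean_space \<Rightarrow> real) \<Rightarrow> 'a \<Rightarrow> real" where
  "laplacian f x = (\<Sum>b\<in>Basis. dderiv (dderiv f b) b x)"

lemma bump_nonneg: "bump k e x y \<ge> 0"
  by (simp add: bump_def flat_def)

lemma bump_support: "e > 0 \<Longrightarrow> bump k e x y \<noteq> 0 \<Longrightarrow> dist x y < e"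
proof -
  assume e: "e > 0" and "bump k e x y \<noteq> 0"
  then have "(y - x) \<bullet> (y - x) < e\<^sup>2"
    by (auto simp: bump_def flat_def field_simps split: if_splits)
  then have "(norm (y - x))\<^sup>2 < e\<^sup>2" by (simp add: power2_norm_eq_inner)
  then show ?thesis using e by (metis dist_commute dist_norm less_eq_real_def power_less_imp_less_base)
qed

lemma tsupport_bump: "e > 0 \<Longrightarrow> tsupport (bump k e x) \<subseteq> cball x e"
  by (rule tsupport_subset) (use bump_support in force)+

lemma test_fun_bump: "e > 0 \<Longrightarrow> test_fun (bump k e x)"
  unfolding test_fun_def
  by (intro conjI compact_tsupport_subset[OF tsupport_bump compact_cball] smooth_gen_smooth[OF smooth_gen.bump])

lemma bump_translate: "bump k e 0 (x - y) = bump k e x y"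
  using inner_minus_left[of "y - x" "y - x"] inner_minus_right[of "x - y" "y - x"]
  by (simp add: bump_def inner_diff_left inner_diff_right algebra_simps)

lemma dderiv_bump:
  "dderiv (bump k e x) h y = (bump (k+2) e x y - real k * bump (k+1) e x y) * (- 2 / e\<^sup>2 * ((y - x) \<bullet> h))"
  by (simp only: frechet_derivative_bump)

lemma dderiv_dderiv_bump:
  "dderiv (dderiv (bump 0 e x) b) b y =
    (bump 4 e x y - 2 * bump 3 e x y) * (- 2 / e\<^sup>2 * ((y - x) \<bullet> b))\<^sup>2 + bump 2 e x y * (- 2 / e\<^sup>2 * (b \<bullet> b))"
proof -
  have "((\<lambda>y. bump 2 e x y * (- 2 / e\<^sup>2 * ((y - x) \<bullet> b))) has_derivative
    (\<lambda>h. bump 2 e x y * (- 2 / e\<^sup>2 * (h \<bullet> b)) +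
      ((bump (2+2) e x y - real 2 * bump (2+1) e x y) * (- 2 / e\<^sup>2 * ((y - x) \<bullet> h))) * (- 2 / e\<^sup>2 * ((y - x) \<bullet> b)))) (at y)"
    by (rule has_derivative_mult[OF bump_has_derivative has_derivative_mult_right])
      (auto intro!: derivative_eq_intros)
  from dderiv_eqI[OF this, of b]
  have "dderiv (\<lambda>y. bump 2 e x y * (- 2 / e\<^sup>2 * ((y - x) \<bullet> b))) b y =
    bump 2 e x y * (- 2 / e\<^sup>2 * (b \<bullet> b)) +
      ((bump (2+2) e x y - real 2 * bump (2+1) e x y) * (- 2 / e\<^sup>2 * ((y - x) \<bullet> b))) * (- 2 / e\<^sup>2 * ((y - x) \<bullet> b))" .
  \<comment> \<open>For \<open>k = 0\<close> the term with factor \<open>real k\<close> drops out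
    and only \<open>bump 2\<close> survives.\<close>
  moreover have "dderiv (bump 0 e x) b = (\<lambda>y. bump 2 e x y * (- 2 / e\<^sup>2 * ((y - x) \<bullet> b)))"
    using dderiv_bump[where k=0 and e=e and x=x and h=b] by (simp add: numeral_2_eq_2)
  ultimately show ?thesis
    by (simp only: power2_eq_square) (simp add: mult.assoc)
qed

lemma laplacian_bump:
  "laplacian (bump 0 e x) (y::'a::euclidean_space) =
    (bump 4 e x y - 2 * bump 3 e x y) * (4 / e ^ 4) * ((y - x) \<bullet> (y - x)) - bump 2 e x y * (2 / e\<^sup>2) * DIM('a)"
proof -
  have "laplacian (bump 0 e x) y = (\<Sum>b\<in>Basis. (bump 4 e x y - 2 * bump 3 e x y) * (4 / e ^ 4) * (((y - x) \<bullet> b) * ((y - x) \<bullet> b)) - bump 2 e x y * (2 / e\<^sup>2))"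
  proof -
    have "A * (- 2 / e\<^sup>2 * t)\<^sup>2 + B * (- 2 / e\<^sup>2 * 1) = A * (4 / e ^ 4) * (t * t) - B * (2 / e\<^sup>2)" for A B t :: real
      by (simp add: power2_eq_square power4_eq_xxxx)
    then show ?thesis
      unfolding laplacian_def dderiv_dderiv_bump by (intro sum.cong) (auto simp: inner_same_Basis)
  qed
  also have "\<dots> = (bump 4 e x y - 2 * bump 3 e x y) * (4 / e ^ 4) * ((y - x) \<bullet> (y - x)) - bump 2 e x y * (2 / e\<^sup>2) * DIM('a)"
    by (subst euclidean_inner[of "y - x" "y - x"]) (simp add: sum_subtractf sum_distrib_left)
  finally show ?thesis .
qed

text \<open>Radiality is read off the explicit formula, so no change of variables for the Laplacian is
  needed later.\<close>

lemma laplacian_bump_cong: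
  fixes x y x' y' :: "'a::euclidean_space"
  assumes "dist x y = dist x' y'"
  shows "laplacian (bump 0 e x) y = laplacian (bump 0 e x') y'"
proof -
  have "(y - x) \<bullet> (y - x) = (y' - x') \<bullet> (y' - x')"
    using assms by (metis dist_commute dist_norm power2_norm_eq_inner)
  then show ?thesis unfolding laplacian_bump bump_def by simp
qed

lemma test_fun_laplacian: "test_fun f \<Longrightarrow> continuous_on UNIV (laplacian f)"
  unfolding laplacian_def[abs_def]
  by (intro continuous_on_sum smooth_continuous smooth_dderiv) (simp add: test_fun_def)

section \<open>Quantitative bounds for the bump, and cutoff functions\<close>

lemma flat_2_le: "flat 2 t \<le> 2"
proof (cases "t > 0")
  case True
  define s where "s = 1 / t"
  have s: "s > 0" using True by (simp add: s_def)
  have "flat 2 t = s\<^sup>2 / exp s"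
    using True by (simp add: flat_def s_def power_divide exp_minus field_simps)
  also have "\<dots> \<le> 2"
    using exp_lower_Taylor_quadratic[of s] s by (simp add: field_simps)
  finally show ?thesis .
qed (simp add: flat_def)

definition bump_mass :: "'a::euclidean_space itself \<Rightarrow> real \<Rightarrow> real" where
  "bump_mass _ e = (\<integral>y. bump 0 e (0::'a) y \<partial>lebesgue)"

lemma bump_integrable: "e > 0 \<Longrightarrow> integrable lebesgue (bump k e x)"
  using integrable_conv[OF continuous_locally_integrable[OF continuous_on_const[of _ 1]] test_fun_bump[of e k 0], of x]
  by (simp add: bump_translate)

lemma bump_integral:
  assumes "e > 0" shows "(\<integral>y. bump 0 e (x::'a::euclidean_space) y \<partial>lebesgue) = bump_mass TYPE('a) e"
proof -
  have "bump 0 e (0::'a) \<in> borel_measurable borel"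
    using test_fun_bump[OF assms, of 0 "0::'a"] smooth_continuous
    by (auto simp: test_fun_def intro!: borel_measurable_continuous_onI)
  from integral_reflect_translate[OF this, of x] show ?thesis
    by (simp add: bump_translate bump_mass_def)
qed

lemma integrable_cball: "integrable lebesgue (indicat_real (cball (x::'a::euclidean_space) r))"
  by (rule lmeasurable_iff_integrable[THEN iffD1]) simp

text \<open>On the ball of half the radius the argument of \<open>flat 0\<close> is at least
  \<open>3 / 4\<close>, so the bump is at least \<open>exp (- 4/3)\<close>;
  \<open>2 ^ DIM('a)\<close> is the ratio of the two volumes. The point is that no constant depends
  on \<open>e\<close>.\<close>

lemma bump_mass_lower:
  assumes e: "e > 0"
  shows "exp (- 4/3) * (measure lebesgue (cball (0::'a::euclidean_space) e) / 2 ^ DIM('a)) \<le> bump_mass TYPE('a) e"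
proof -
  have "measure lebesgue (cball (0::'a) e) / 2 ^ DIM('a) = measure lebesgue (cball (0::'a) (e / 2))"
    using e by (simp add: content_cball power_divide)
  then have "exp (- 4/3) * (measure lebesgue (cball (0::'a) e) / 2 ^ DIM('a)) 
    = (\<integral>y. exp (- 4/3) * indicator (cball (0::'a) (e / 2)) y \<partial>lebesgue)"
    by simp
  also have "\<dots> \<le> bump_mass TYPE('a) e" unfolding bump_mass_def
  proof (rule integral_mono[OF _ bump_integrable[OF e]])
    show "integrable lebesgue (\<lambda>y. exp (- 4/3 :: real) * indicator (cball (0::'a) (e / 2)) y)"
      by (rule integrable_mult_right) (rule integrable_cball)
    fix y :: 'a
    show "exp (- 4/3) * indicator (cball (0::'a) (e / 2)) y \<le> bump 0 e 0 y"
    proof (cases "y \<in> cball 0 (e / 2)")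
      case True
      then have "(norm y)\<^sup>2 \<le> (e / 2)\<^sup>2" by (intro power_mono) auto
      then have "(y \<bullet> y) / e\<^sup>2 \<le> 1 / 4"
        using e by (simp add: power2_norm_eq_inner field_simps)
      then have t: "3 / 4 \<le> 1 - (y \<bullet> y) / e\<^sup>2" (is "_ \<le> ?t") by simp
      then have "1 / ?t \<le> 4 / 3" by (simp add: divide_simps)
      moreover have "0 < ?t" using t by linarith
      ultimately show ?thesis using True by (simp only: bump_def flat_def diff_0_right) simp
    qed (simp add: bump_nonneg)
  qed
  finally show ?thesis .
qed

lemma bump_mass_pos:
  assumes "e > 0" shows "bump_mass TYPE('a::euclidean_space) e > 0"
proof -
  have "0 < exp (- 4/3) * (measure lebesgue (cball (0::'a) e) / 2 ^ DIM('a))"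
    using assms by (simp add: content_cball unit_ball_vol_pos)
  also note bump_mass_lower[OF assms]
  finally show ?thesis .
qed

text \<open>Mollifying the indicator of \<open>A\<close> with radius \<open>e\<close> confines the
  transition to depths between \<open>e\<close> and \<open>3 * e\<close>: the threshold
  \<open>2 * e\<close> leaves one radius of margin on either side. The gradient is at most
  \<open>4 / e\<close> times the ratio of ball volume to bump mass, which
  \<open>bump_mass_lower\<close> bounds independently of \<open>e\<close>.\<close>

lemma exists_cutoff:
  fixes D :: "'a::euclidean_space set"
  assumes D: "open D" "D \<noteq> UNIV" and e: "e > 0"
  obtains \<zeta> where "smooth_on UNIV \<zeta>"
    "\<And>x. 0 \<le> \<zeta> x" "\<And>x. \<zeta> x \<le> 1" "\<And>x. x \<notin> D \<Longrightarrow> \<zeta> x = 0" "\<And>x. infdist x (- D) > 3 * e \<Longrightarrow> \<zeta> x = 1"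
    "\<And>x b. x \<notin> D \<Longrightarrow> dderiv \<zeta> b x = 0" "\<And>x b. infdist x (- D) > 3 * e \<Longrightarrow> dderiv \<zeta> b x = 0"
    "\<And>x b. b \<in> Basis \<Longrightarrow> \<bar>dderiv \<zeta> b x\<bar> \<le> (4 * exp (4/3) * 2 ^ DIM('a)) / e"
proof -
  define A where "A = {y. infdist y (- D) \<ge> 2 * e}"
  have "closed A" unfolding A_def by (intro closed_Collect_le continuous_intros)
  then have A: "A \<in> sets lebesgue" by simp
  note lA = locally_integrable_indicator[OF A]
  define M where "M = bump_mass TYPE('a) e"
  have M: "M > 0" unfolding M_def by (rule bump_mass_pos[OF e])
  define f where "f = bump 0 e (0::'a)"
  have f: "test_fun f" unfolding f_def by (rule test_fun_bump[OF e])
  define c where "c x = (\<integral>y. indicator A y * f (x - y) \<partial>lebesgue)" for x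
  define \<zeta> where "\<zeta> x = (1 / M) * c x" for x
  have sc: "smooth_on UNIV c" unfolding c_def[abs_def] by (rule smooth_conv[OF lA f])
  have s: "smooth_on UNIV \<zeta>" unfolding \<zeta>_def[abs_def]
    by (rule smooth_gen_smooth[OF smooth_gen.mult[OF smooth_gen.const smooth_gen.smooth[OF sc]]])
  have dc: "dderiv c b x = (\<integral>y. indicator A y * dderiv f b (x - y) \<partial>lebesgue)" for b x
    unfolding c_def[abs_def] by (rule dderiv_conv[OF lA f])
  have d\<zeta>: "dderiv \<zeta> b x = (1 / M) * dderiv c b x" for b x
    unfolding \<zeta>_def[abs_def]
    by (rule dderiv_eqI) (rule has_derivative_mult_right[OF smooth_has_derivative[OF sc]])
  have f_eq: "f (x - y) = bump 0 e x y" for x y by (simp add: f_def bump_translate)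
  have supp: "dist x y < e" if "f (x - y) \<noteq> 0" for x y
    using bump_support[OF e] that by (simp add: f_eq)
  have dsupp: "dist x y \<le> e" if "dderiv f b (x - y) \<noteq> 0" for b x y
  proof -
    have "x - y \<in> tsupport f" using dderiv_zero_off_tsupport that by blast
    then have "x - y \<in> cball 0 e" using tsupport_bump[OF e, of 0 "0::'a"] unfolding f_def by blast
    then show ?thesis by (simp add: dist_norm norm_minus_commute)
  qed
  have lip: "infdist y (- D) \<le> infdist x (- D) + dist x y" for x y
    using infdist_triangle[of y "- D" x] by (simp add: dist_commute)
  have out: "y \<notin> A" if "x \<notin> D" "dist x y \<le> e" for x y
  proof -
    have "infdist x (- D) = 0" using that by simp
    then show ?thesis using lip[of y x] that e by (simp add: A_def)
  qed
  have inn: "y \<in> A" if "infdist x (- D) > 3 * e" "dist x y \<le> e" for x y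
    using lip[of x y] that by (simp add: A_def dist_commute)
  have ci: "integrable lebesgue (\<lambda>y. f (x - y))" "(\<integral>y. f (x - y) \<partial>lebesgue) = M" for x
    using bump_integrable[OF e, of 0 x] bump_integral[OF e, of x] by (auto simp: f_eq M_def)
  have nn: "0 \<le> f z" for z by (simp add: f_def bump_nonneg)
  have c0: "0 \<le> c x" for x unfolding c_def by (rule Bochner_Integration.integral_nonneg) (simp add: nn)
  have c1: "c x \<le> M" for x
    unfolding c_def ci(2)[of x, symmetric]
    by (rule integral_mono[OF integrable_conv[OF lA f] ci(1)]) (simp add: nn indicator_def)
  show ?thesis
  proof (rule that[OF s])
    fix x :: 'a
    show "0 \<le> \<zeta> x" "\<zeta> x \<le> 1" using c0 c1 M by (auto simp: \<zeta>_def field_simps)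
    {
      assume x: "x \<notin> D"
      have "(\<lambda>y. indicator A y * f (x - y)) = (\<lambda>_. 0)"
        using out[OF x] supp less_imp_le by (fastforce simp: indicator_def)
      then show "\<zeta> x = 0" by (simp add: \<zeta>_def c_def)
      fix b :: 'a
      have "(\<lambda>y. indicator A y * dderiv f b (x - y)) = (\<lambda>_. 0)"
        using out[OF x] dsupp by (fastforce simp: indicator_def)
      then show "dderiv \<zeta> b x = 0" unfolding d\<zeta> dc by simp
    }
    {
      assume x: "infdist x (- D) > 3 * e"
      have "(\<lambda>y. indicator A y * f (x - y)) = (\<lambda>y. f (x - y))"
        using inn[OF x] supp less_imp_le by (fastforce simp: indicator_def)
      then show "\<zeta> x = 1" using M by (simp add: \<zeta>_def c_def ci)
      fix b :: 'a
      have "(\<lambda>y. indicator A y * dderiv f b (x - y)) = (\<lambda>y. dderiv f b (x - y))"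
        using inn[OF x] dsupp by (fastforce simp: indicator_def)
      \<comment> \<open>At such depth the whole support of the mollifier lies in \<open>A\<close>,
        so what remains is the full integral of a derivative.\<close>
      moreover have "(\<integral>y. dderiv f b (x - y) \<partial>lebesgue) = 0"
        using integral_dderiv_zero[OF f, of b] integral_reflect_translate[of "dderiv f b" x]
          smooth_continuous[of "dderiv f b"] test_fun_dderiv[OF f, of b]
        by (simp add: test_fun_def borel_measurable_continuous_onI)
      ultimately show "dderiv \<zeta> b x = 0" unfolding d\<zeta> dc by simp
    }
    fix b :: 'a assume b: "b \<in> Basis"
    define V where "V = measure lebesgue (cball (0::'a) e)"
    have Vx: "measure lebesgue (cball x e) = V" using e by (simp add: V_def content_cball)
    have "\<bar>dderiv c b x\<bar> \<le> (\<integral>y. 4 / e * indicator (cball x e) y \<partial>lebesgue)"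
      unfolding dc real_norm_def[symmetric]
    proof (rule order_trans[OF integral_norm_bound integral_mono[OF integrable_norm]])
      show "integrable lebesgue (\<lambda>y. indicator A y * dderiv f b (x - y))"
        by (rule integrable_conv[OF lA test_fun_dderiv[OF f]])
      show "integrable lebesgue (\<lambda>y. 4 / e * indicator (cball x e) y)"
        by (rule integrable_mult_right) (rule integrable_cball)
      fix y :: 'a
      show "norm (indicator A y * dderiv f b (x - y)) \<le> 4 / e * indicator (cball x e) y"
      proof (cases "dist x y \<le> e")
        case True
        have "\<bar>dderiv f b (x - y)\<bar> = bump 2 e 0 (x - y) * (2 / e\<^sup>2 * \<bar>(x - y) \<bullet> b\<bar>)"
          unfolding f_def dderiv_bump using bump_nonneg[of 2 e 0 "x - y"] by (simp add: abs_mult numeral_2_eq_2[symmetric])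
        also have "\<dots> \<le> 2 * (2 / e\<^sup>2 * e)"
        proof (intro mult_mono)
          show "bump 2 e 0 (x - y) \<le> 2" by (simp add: bump_def flat_2_le)
          show "\<bar>(x - y) \<bullet> b\<bar> \<le> e" using Basis_le_norm[OF b, of "x - y"] True by (simp add: dist_norm)
        qed (use e in auto)
        also have "\<dots> = 4 / e" using e by (simp add: power2_eq_square)
        finally show ?thesis using True e by (auto simp: indicator_def)
      next
        case False
        then have "dderiv f b (x - y) = 0" using dsupp by force
        then show ?thesis using e by simp
      qed
    qed
    also have "\<dots> = 4 / e * V" by (simp add: Vx)
    finally have "\<bar>dderiv \<zeta> b x\<bar> \<le> (1 / M) * (4 / e * V)"
      unfolding d\<zeta> abs_mult using M by (intro mult_mono) auto
    also have "\<dots> \<le> (4 * exp (4/3) * 2 ^ DIM('a)) / e"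
    proof -
      have "V \<le> exp (4/3) * 2 ^ DIM('a) * M"
        using bump_mass_lower[OF e, where 'a='a] unfolding V_def[symmetric] M_def[symmetric]
        by (simp add: exp_minus field_simps)
      then show ?thesis using e M by (simp add: field_simps)
    qed
    finally show "\<bar>dderiv \<zeta> b x\<bar> \<le> (4 * exp (4/3) * 2 ^ DIM('a)) / e" .
  qed
qed

subsection \<open>The transmission condition\<close>

text \<open>The segment from \<open>x\<close> to \<open>z\<close> crosses the frontier, where
  \<open>u = d\<close>, at a point no farther from \<open>x\<close> than \<open>z\<close>.\<close>

lemma lipschitz_to_frontier:
  fixes u :: "'a::euclidean_space \<Rightarrow> real"
  assumes "L-lipschitz_on UNIV u" "\<forall>x\<in>frontier D. u x = d" "x \<in> D" "z \<notin> D"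
  shows "\<bar>u x - d\<bar> \<le> L * dist x z"
proof -
  have "closed_segment x z \<inter> frontier D \<noteq> {}"
    using assms(3,4) by (intro connected_Int_frontier) auto
  then obtain p where p: "p \<in> closed_segment x z" "p \<in> frontier D" by blast
  have "\<bar>u x - d\<bar> \<le> L * dist x p"
    using lipschitz_onD[OF assms(1), of x p] assms(2) p(2) by (simp add: dist_real_def)
  also have "\<dots> \<le> L * dist x z"
    using dist_in_closed_segment[OF p(1)] lipschitz_on_nonneg[OF assms(1)]
    by (intro mult_left_mono) (auto simp: dist_commute)
  finally show ?thesis .
qed

text \<open>Reduces the vector identity to scalar ones. Both vector-valued integrands are shown
  integrable before the inner product with \<open>b\<close> is moved through the integral.\<close>

lemma weak_grad_component:
  assumes "weak_grad u g" "continuous_on UNIV u" "test_fun f" "b \<in> Basis"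
  shows "locally_integrable (\<lambda>x. g x \<bullet> b)"
    and "(\<integral>x. u x * dderiv f b x \<partial>lebesgue) = - (\<integral>x. (g x \<bullet> b) * f x \<partial>lebesgue)"
proof -
  have sf: "smooth_on UNIV f" using assms by (simp add: test_fun_def)
  obtain R where R: "\<And>x. f x \<noteq> 0 \<Longrightarrow> norm x \<le> R" "\<And>x v. dderiv f v x \<noteq> 0 \<Longrightarrow> norm x \<le> R"
    using test_fun_support[OF assms(3)] by metis
  show l: "locally_integrable (\<lambda>x. g x \<bullet> b)" for b
    unfolding locally_integrable_def
  proof (intro allI impI)
    fix K :: "'a set" assume "compact K"
    then have "integrable lebesgue (\<lambda>x. indicator K x *\<^sub>R g x)"
      using assms(1) by (simp add: weak_grad_def set_integrable_def)
    from integrable_inner_left[OF this, of b] show "set_integrable lebesgue K (\<lambda>x. g x \<bullet> b)"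
      by (simp add: set_integrable_def)
  qed
  have i1: "integrable lebesgue (\<lambda>x. f x *\<^sub>R g x)"
  proof -
    have "f x *\<^sub>R g x = (\<Sum>b\<in>Basis. ((g x \<bullet> b) * f x) *\<^sub>R b)" for x
    proof -
      have "f x *\<^sub>R g x = f x *\<^sub>R (\<Sum>b\<in>Basis. (g x \<bullet> b) *\<^sub>R b)" by (simp add: euclidean_representation)
      then show ?thesis by (simp add: scaleR_sum_right mult.commute)
    qed
    then show ?thesis
      using integrable_locally_integrable_mult[OF l smooth_continuous[OF sf] R(1)] by simp
  qed
  have i2: "integrable lebesgue (\<lambda>x. u x *\<^sub>R grad f x)"
    unfolding grad_def scaleR_sum_right scaleR_scaleR
    by (intro Bochner_Integration.integrable_sum integrable_scaleR_left
        integrable_locally_integrable_mult[OF continuous_locally_integrable[OF assms(2)] smooth_continuous[OF smooth_dderiv[OF sf]] R(2)])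
  have gb: "grad f x \<bullet> b = dderiv f b x" for x
    using \<open>b \<in> Basis\<close> by (simp add: grad_def inner_sum_left inner_Basis if_distrib[of "\<lambda>t. _ * t"] cong: if_cong)
  have "(\<integral>x. u x * dderiv f b x \<partial>lebesgue) = (\<integral>x. (u x *\<^sub>R grad f x) \<bullet> b \<partial>lebesgue)"
    by (simp add: gb)
  also have "\<dots> = (\<integral>x. u x *\<^sub>R grad f x \<partial>lebesgue) \<bullet> b"
    using i2 by (rule integral_inner_left)
  also have "\<dots> = - ((\<integral>x. f x *\<^sub>R g x \<partial>lebesgue) \<bullet> b)"
    using assms(1,3) by (simp add: weak_grad_def)
  also have "(\<integral>x. f x *\<^sub>R g x \<partial>lebesgue) \<bullet> b = (\<integral>x. (f x *\<^sub>R g x) \<bullet> b \<partial>lebesgue)"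
    using i1 by (rule integral_inner_left[symmetric])
  finally show "(\<integral>x. u x * dderiv f b x \<partial>lebesgue) = - (\<integral>x. (g x \<bullet> b) * f x \<partial>lebesgue)"
    by (simp add: mult.commute)
qed

text \<open>Cut off at distance \<open>e\<close> from the boundary: the gradient of the cutoff is of order \<open>1 / e\<close>, but it
  lives where \<open>\<bar>u - d\<bar>\<close> is of order \<open>e\<close>, so the error is bounded and supported in a vanishing set.
  No trace or divergence theorem is involved.\<close>

lemma weak_grad_indicator:
  fixes u :: "'a::euclidean_space \<Rightarrow> real"
  assumes g: "weak_grad u g" and L: "L-lipschitz_on UNIV u" and f: "test_fun f" and b: "b \<in> Basis"
    and D: "open D" "D \<noteq> UNIV" and ud: "\<forall>x\<in>frontier D. u x = d"
  shows "(\<integral>x. (g x \<bullet> b) * (indicator D x * f x) \<partial>lebesgue) = - (\<integral>x. (u x - d) * (indicator D x * dderiv f b x) \<partial>lebesgue)"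
proof -
  have sf: "smooth_on UNIV f" using f by (simp add: test_fun_def)
  have uc: "continuous_on UNIV u" using L by (rule lipschitz_on_continuous_on)
  have ne: "- D \<noteq> {}" using D(2) by auto
  obtain R where R: "\<And>x. f x \<noteq> 0 \<Longrightarrow> norm x \<le> R" "\<And>x v. dderiv f v x \<noteq> 0 \<Longrightarrow> norm x \<le> R"
    using test_fun_support[OF f] by metis
  define C :: real where "C = 4 * exp (4/3) * 2 ^ DIM('a)"
  define e where "e n = 1 / real (Suc n)" for n
  have e: "e n > 0" for n by (simp add: e_def)
  have e_lim: "e \<longlonglongrightarrow> 0" unfolding e_def[abs_def] by (rule LIMSEQ_Suc[OF lim_1_over_n])
  have "\<exists>z. smooth_on UNIV z \<and> (\<forall>x. 0 \<le> z x) \<and> (\<forall>x. z x \<le> 1) \<and> (\<forall>x. x \<notin> D \<longrightarrow> z x = 0) \<and>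
    (\<forall>x. infdist x (- D) > 3 * e n \<longrightarrow> z x = 1) \<and> (\<forall>x. x \<notin> D \<longrightarrow> dderiv z b x = 0) \<and>
    (\<forall>x. infdist x (- D) > 3 * e n \<longrightarrow> dderiv z b x = 0) \<and> (\<forall>x. \<bar>dderiv z b x\<bar> \<le> C / e n)" for n
    using b by (rule_tac exists_cutoff[OF D e[of n]]) (auto simp: C_def)
  then obtain z where z: "\<And>n. smooth_on UNIV (z n)" "\<And>n x. 0 \<le> z n x" "\<And>n x. z n x \<le> 1"
    "\<And>n x. x \<notin> D \<Longrightarrow> z n x = 0" "\<And>n x. infdist x (- D) > 3 * e n \<Longrightarrow> z n x = 1"
    "\<And>n x. x \<notin> D \<Longrightarrow> dderiv (z n) b x = 0" "\<And>n x. infdist x (- D) > 3 * e n \<Longrightarrow> dderiv (z n) b x = 0"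
    "\<And>n x. \<bar>dderiv (z n) b x\<bar> \<le> C / e n"
    by metis
  have ev: "eventually (\<lambda>n. infdist x (- D) > 3 * e n) sequentially" if "x \<in> D" for x
  proof -
    have "infdist x (- D) > 0"
      using that D(1) ne by (intro infdist_pos_not_in_closed) auto
    moreover have "(\<lambda>n. 3 * e n) \<longlonglongrightarrow> 3 * 0" by (intro tendsto_intros e_lim)
    ultimately show ?thesis using order_tendstoD(2)[of _ "3 * 0"] by fastforce
  qed
  have zm: "z n \<in> borel_measurable lebesgue" "dderiv (z n) b \<in> borel_measurable lebesgue" for n
    using smooth_continuous[OF z(1)] smooth_continuous[OF smooth_dderiv[OF z(1)]]
    by (auto intro!: measurable_completion borel_measurable_continuous_onI)
  have iD[measurable]: "indicat_real D \<in> borel_measurable lebesgue"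
    using D(1) by (intro borel_measurable_indicator) simp
  have z_lim: "(\<lambda>n. z n x) \<longlonglongrightarrow> indicator D x" for x
  proof (cases "x \<in> D")
    case True
    from ev[OF True] have "eventually (\<lambda>n. z n x = indicator D x) sequentially"
      by eventually_elim (simp add: z True)
    then show ?thesis by (rule tendsto_eventually)
  qed (simp add: z)
  have dz_lim: "(\<lambda>n. dderiv (z n) b x) \<longlonglongrightarrow> 0" for x
  proof (cases "x \<in> D")
    case True
    from ev[OF True] have "eventually (\<lambda>n. dderiv (z n) b x = 0) sequentially"
      by eventually_elim (simp add: z)
    then show ?thesis by (rule tendsto_eventually)
  qed (simp add: z)
  \<comment> \<open>Since the cutoffs take values between 0 and 1, \<open>w x * h x\<close>
    dominates.\<close>
  have lim_aux: "(\<lambda>n. \<integral>x. w x * (z n x * h x) \<partial>lebesgue) \<longlonglongrightarrow> (\<integral>x. w x * (indicator D x * h x) \<partial>lebesgue)"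
    if i: "integrable lebesgue (\<lambda>x. w x * h x)" for w h
  proof (rule integral_dominated_convergence[where w="\<lambda>x. \<bar>w x * h x\<bar>"])
    have eq: "(\<lambda>x. w x * (s x * h x)) = (\<lambda>x. s x * (w x * h x))" for s by (simp add: mult_ac)
    show "(\<lambda>x. w x * (indicator D x * h x)) \<in> borel_measurable lebesgue"
      unfolding eq using borel_measurable_integrable[OF i] by measurable
    show "(\<lambda>x. w x * (z n x * h x)) \<in> borel_measurable lebesgue" for n
      unfolding eq using borel_measurable_integrable[OF i] zm(1)[of n] by measurable
    show "integrable lebesgue (\<lambda>x. \<bar>w x * h x\<bar>)" using i by simp
    show "AE x in lebesgue. (\<lambda>n. w x * (z n x * h x)) \<longlonglongrightarrow> w x * (indicator D x * h x)"
      by (intro AE_I2 tendsto_intros z_lim)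
    show "AE x in lebesgue. norm (w x * (z n x * h x)) \<le> \<bar>w x * h x\<bar>" for n
    proof (rule AE_I2)
      fix x
      have "\<bar>z n x\<bar> * \<bar>w x * h x\<bar> \<le> 1 * \<bar>w x * h x\<bar>"
        by (rule mult_right_mono) (use z(2,3)[of n x] in auto)
      then show "norm (w x * (z n x * h x)) \<le> \<bar>w x * h x\<bar>" by (simp add: abs_mult mult_ac)
    qed
  qed
  have i0: "integrable lebesgue (\<lambda>x. w x * f x)" "integrable lebesgue (\<lambda>x. w x * dderiv f b x)" if "locally_integrable w" for w
    using integrable_locally_integrable_mult[OF that smooth_continuous[OF sf] R(1)]
      integrable_locally_integrable_mult[OF that smooth_continuous[OF smooth_dderiv[OF sf]] R(2)] by auto
  have udc: "continuous_on UNIV (\<lambda>x. u x - d)" by (intro continuous_intros uc)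
  have lu: "locally_integrable (\<lambda>x. u x - d)" "locally_integrable u" "locally_integrable (\<lambda>_. d)"
    by (intro continuous_locally_integrable udc uc continuous_on_const)+
  note lg = weak_grad_component(1)[OF g uc f b]
  have T1: "(\<lambda>n. \<integral>x. (u x - d) * (z n x * dderiv f b x) \<partial>lebesgue) \<longlonglongrightarrow> (\<integral>x. (u x - d) * (indicator D x * dderiv f b x) \<partial>lebesgue)"
    by (rule lim_aux[OF i0(2)[OF lu(1)]])
  have T3: "(\<lambda>n. \<integral>x. (g x \<bullet> b) * (z n x * f x) \<partial>lebesgue) \<longlonglongrightarrow> (\<integral>x. (g x \<bullet> b) * (indicator D x * f x) \<partial>lebesgue)"
    by (rule lim_aux[OF i0(1)[OF lg]])
  have dz_bound: "\<bar>(u x - d) * dderiv (z n) b x\<bar> \<le> 3 * L * C" for n x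
  proof (cases "dderiv (z n) b x = 0")
    case True
    then show ?thesis using lipschitz_on_nonneg[OF L] by (simp add: C_def)
  next
    case False
    then have x: "x \<in> D" "infdist x (- D) \<le> 3 * e n" using z(6,7) by force+
    obtain p where p: "p \<in> - D" "infdist x (- D) = dist x p"
      using infdist_attains_inf[of "- D" x] D(1) ne by auto
    have "\<bar>u x - d\<bar> \<le> L * dist x p"
      by (rule lipschitz_to_frontier[OF L ud x(1)]) (use p in auto)
    also have "\<dots> \<le> L * (3 * e n)"
      using x p lipschitz_on_nonneg[OF L] by (intro mult_left_mono) auto
    finally have "\<bar>u x - d\<bar> * \<bar>dderiv (z n) b x\<bar> \<le> (L * (3 * e n)) * (C / e n)"
      using z(8)[of n x] by (intro mult_mono) auto
    also have "\<dots> = 3 * L * C" using e[of n] by simp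
    finally show ?thesis by (simp add: abs_mult)
  qed
  have if0: "integrable lebesgue (\<lambda>x. \<bar>3 * L * C\<bar> * \<bar>f x\<bar>)"
    using i0(1)[OF continuous_locally_integrable[OF continuous_on_const[of _ 1]]] by simp
  have T2i: "integrable lebesgue (\<lambda>x. (u x - d) * (dderiv (z n) b x * f x))" for n
    using integrable_locally_integrable_mult[OF lu(1), of "\<lambda>x. dderiv (z n) b x * f x" R] R(1)
      smooth_continuous[OF smooth_mult[OF smooth_dderiv[OF z(1)] sf]] by auto
  \<comment> \<open>This is the boundary-layer term. Each point of \<open>D\<close> eventually has
    depth above \<open>3 * e n\<close>, where the cutoff has zero gradient, so the integrand tends
    to 0 pointwise under the bound \<open>dz_bound\<close>.\<close>
  have T2: "(\<lambda>n. \<integral>x. (u x - d) * (dderiv (z n) b x * f x) \<partial>lebesgue) \<longlonglongrightarrow> (\<integral>x. 0 \<partial>(lebesgue :: 'a measure))"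
  proof (rule integral_dominated_convergence[where w="\<lambda>x. \<bar>3 * L * C\<bar> * \<bar>f x\<bar>"])
    show "integrable lebesgue (\<lambda>x. \<bar>3 * L * C\<bar> * \<bar>f x\<bar>)" by (rule if0)
    show "(\<lambda>x. (u x - d) * (dderiv (z n) b x * f x)) \<in> borel_measurable lebesgue" for n
      using T2i by (rule borel_measurable_integrable)
    have "(\<lambda>n. (u x - d) * (dderiv (z n) b x * f x)) \<longlonglongrightarrow> (u x - d) * (0 * f x)" for x
      by (intro tendsto_intros dz_lim)
    then show "AE x in lebesgue. (\<lambda>n. (u x - d) * (dderiv (z n) b x * f x)) \<longlonglongrightarrow> 0" by simp
    show "AE x in lebesgue. norm ((u x - d) * (dderiv (z n) b x * f x)) \<le> \<bar>3 * L * C\<bar> * \<bar>f x\<bar>" for n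
    proof (rule AE_I2)
      fix x
      have "\<bar>(u x - d) * dderiv (z n) b x\<bar> * \<bar>f x\<bar> \<le> \<bar>3 * L * C\<bar> * \<bar>f x\<bar>"
        using dz_bound[of x n] by (intro mult_right_mono) auto
      then show "norm ((u x - d) * (dderiv (z n) b x * f x)) \<le> \<bar>3 * L * C\<bar> * \<bar>f x\<bar>"
        by (simp add: abs_mult mult_ac)
    qed
  qed simp
  have eq: "(\<integral>x. (g x \<bullet> b) * (z n x * f x) \<partial>lebesgue) = - ((\<integral>x. (u x - d) * (z n x * dderiv f b x) \<partial>lebesgue) + (\<integral>x. (u x - d) * (dderiv (z n) b x * f x) \<partial>lebesgue))" for n
  proof -
    note t = test_fun_mult[OF z(1)[of n] f]
    note dt = dderiv_mult[OF z(1)[of n] sf, where v=b]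
    have st: "smooth_on UNIV (\<lambda>x. z n x * f x)" using t by (simp add: test_fun_def)
    obtain R' where R': "\<And>x. dderiv (\<lambda>x. z n x * f x) b x \<noteq> 0 \<Longrightarrow> norm x \<le> R'"
      using test_fun_support[OF t] by metis
    have it: "integrable lebesgue (\<lambda>x. w x * dderiv (\<lambda>x. z n x * f x) b x)" if "locally_integrable w" for w
      by (rule integrable_locally_integrable_mult[OF that smooth_continuous[OF smooth_dderiv[OF st]] R'])
    have i1: "integrable lebesgue (\<lambda>x. (u x - d) * (z n x * dderiv f b x))"
      using integrable_locally_integrable_mult[OF lu(1), of "\<lambda>x. z n x * dderiv f b x" R] R(2)
        smooth_continuous[OF smooth_mult[OF z(1) smooth_dderiv[OF sf]]] by auto
    have "(\<integral>x. (g x \<bullet> b) * (z n x * f x) \<partial>lebesgue) = - (\<integral>x. u x * dderiv (\<lambda>x. z n x * f x) b x \<partial>lebesgue)"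
      using weak_grad_component(2)[OF g uc t b] by simp
    \<comment> \<open>The constant \<open>d\<close> may be subtracted because a derivative of a test
      function has integral zero. Only \<open>u - d\<close>, not \<open>u\<close>, is small in the
      boundary layer.\<close>
    also have "(\<integral>x. u x * dderiv (\<lambda>x. z n x * f x) b x \<partial>lebesgue) = (\<integral>x. (u x - d) * dderiv (\<lambda>x. z n x * f x) b x \<partial>lebesgue)"
      using it[OF lu(2)] it[OF lu(3)] integral_dderiv_zero[OF t, of b] by (simp add: left_diff_distrib)
    also have "\<dots> = (\<integral>x. (u x - d) * (z n x * dderiv f b x) + (u x - d) * (dderiv (z n) b x * f x) \<partial>lebesgue)"
      by (simp add: dt distrib_left)
    also have "\<dots> = (\<integral>x. (u x - d) * (z n x * dderiv f b x) \<partial>lebesgue) + (\<integral>x. (u x - d) * (dderiv (z n) b x * f x) \<partial>lebesgue)"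
      by (rule Bochner_Integration.integral_add[OF i1 T2i])
    finally show ?thesis .
  qed
  have "(\<lambda>n. \<integral>x. (g x \<bullet> b) * (z n x * f x) \<partial>lebesgue) \<longlonglongrightarrow> - ((\<integral>x. (u x - d) * (indicator D x * dderiv f b x) \<partial>lebesgue) + (\<integral>x. 0 \<partial>(lebesgue :: 'a measure)))"
    unfolding eq by (intro tendsto_intros T1 T2)
  from LIMSEQ_unique[OF T3 this] show ?thesis by simp
qed

text \<open>The flux is the weak gradient of
  \<open>q * u + (p - q) * (indicator D * (u - d))\<close>: the first summand is covered by the
  definition of \<open>weak_grad\<close>, the second by \<open>weak_grad_indicator\<close>. Since
  \<open>u - d\<close> vanishes on the frontier, no surface term appears.\<close>

lemma transmission_identity:
  fixes u :: "'a::euclidean_space \<Rightarrow> real"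
  assumes g: "weak_grad u g" and L: "L-lipschitz_on UNIV u" and f: "test_fun f"
    and D: "open D" "D \<noteq> UNIV" and ud: "\<forall>x\<in>frontier D. u x = d"
  shows "(\<integral>x. (if x \<in> D then p else q) * (g x \<bullet> grad f x) \<partial>lebesgue) =
    - (\<integral>x. (q * u x + (p - q) * (indicator D x * (u x - d))) * laplacian f x \<partial>lebesgue)"
proof -
  have sf: "smooth_on UNIV f" using f by (simp add: test_fun_def)
  have uc: "continuous_on UNIV u" using L by (rule lipschitz_on_continuous_on)
  obtain R where R: "\<And>x v. dderiv f v x \<noteq> 0 \<Longrightarrow> norm x \<le> R" using test_fun_support[OF f] by metis
  obtain R2 where R2: "\<And>b x v. b \<in> Basis \<Longrightarrow> dderiv (dderiv f b) v x \<noteq> 0 \<Longrightarrow> norm x \<le> R2"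
  proof -
    obtain S where S: "\<And>x. x \<in> tsupport f \<Longrightarrow> norm x \<le> S"
      using f unfolding test_fun_def by (metis bounded_iff compact_imp_bounded)
    have "x \<in> tsupport f" if "dderiv (dderiv f b) v x \<noteq> 0" for b v x
      using that dderiv_zero_off_tsupport[of x "dderiv f b" v] tsupport_dderiv[of f b] by auto
    then show ?thesis using S that by blast
  qed
  have lD: "locally_integrable (\<lambda>x. indicator D x * w x)" if "locally_integrable w" for w
    unfolding locally_integrable_def set_integrable_def
  proof (intro allI impI)
    fix K :: "'a set" assume "compact K"
    then have "integrable lebesgue (\<lambda>x. indicator K x *\<^sub>R w x)"
      using that by (simp add: locally_integrable_def set_integrable_def)
    from integrable_mult_indicator[OF _ this, of D] D(1)
    have "integrable lebesgue (\<lambda>x. indicator D x *\<^sub>R (indicator K x *\<^sub>R w x))" by simp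
    then show "integrable lebesgue (\<lambda>x. indicator K x *\<^sub>R (indicator D x * w x))"
      by (simp add: mult.left_commute)
  qed
  have lu: "locally_integrable u" "locally_integrable (\<lambda>x. u x - d)"
    by (intro continuous_locally_integrable uc continuous_intros)+
  have i2: "integrable lebesgue (\<lambda>x. w x * dderiv (dderiv f b) b x)" if "locally_integrable w" "b \<in> Basis" for w b
    by (rule integrable_locally_integrable_mult[OF that(1) smooth_continuous[OF smooth_dderiv[OF smooth_dderiv[OF sf]]] R2[OF that(2)]])
  have i1: "integrable lebesgue (\<lambda>x. w x * dderiv f b x)" if "locally_integrable w" for w b
    by (rule integrable_locally_integrable_mult[OF that(1) smooth_continuous[OF smooth_dderiv[OF sf]] R])
  \<comment> \<open>Both integration formulas are applied with the derivative
    \<open>dderiv f b\<close> as test function, which produces the second derivative on the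
    right.\<close>
  have comp: "(\<integral>x. (q + (p - q) * indicator D x) * ((g x \<bullet> b) * dderiv f b x) \<partial>lebesgue) =
     - (\<integral>x. (q * u x + (p - q) * (indicator D x * (u x - d))) * dderiv (dderiv f b) b x \<partial>lebesgue)" if b: "b \<in> Basis" for b
  proof -
    note tb = test_fun_dderiv[OF f, of b]
    note lg = weak_grad_component(1)[OF g uc tb b]
    have "(\<integral>x. (q + (p - q) * indicator D x) * ((g x \<bullet> b) * dderiv f b x) \<partial>lebesgue)
      = (\<integral>x. q * ((g x \<bullet> b) * dderiv f b x) + (p - q) * ((g x \<bullet> b) * (indicator D x * dderiv f b x)) \<partial>lebesgue)"
      by (simp add: algebra_simps)
    also have "\<dots> = q * (\<integral>x. (g x \<bullet> b) * dderiv f b x \<partial>lebesgue) + (p - q) * (\<integral>x. (g x \<bullet> b) * (indicator D x * dderiv f b x) \<partial>lebesgue)"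
      using i1[OF lg, of b] i1[OF lD[OF lg], of b] by (simp add: mult_ac)
    also have "\<dots> = - (q * (\<integral>x. u x * dderiv (dderiv f b) b x \<partial>lebesgue) + (p - q) * (\<integral>x. (u x - d) * (indicator D x * dderiv (dderiv f b) b x) \<partial>lebesgue))"
      unfolding weak_grad_component(2)[OF g uc tb b] weak_grad_indicator[OF g L tb b D ud] by simp
    also have "q * (\<integral>x. u x * dderiv (dderiv f b) b x \<partial>lebesgue) + (p - q) * (\<integral>x. (u x - d) * (indicator D x * dderiv (dderiv f b) b x) \<partial>lebesgue)
      = (\<integral>x. q * (u x * dderiv (dderiv f b) b x) + (p - q) * (indicator D x * (u x - d) * dderiv (dderiv f b) b x) \<partial>lebesgue)"
      using i2[OF lu(1) b] i2[OF lD[OF lu(2)] b] by (simp add: mult_ac)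
    also have "\<dots> = (\<integral>x. (q * u x + (p - q) * (indicator D x * (u x - d))) * dderiv (dderiv f b) b x \<partial>lebesgue)"
      by (simp add: algebra_simps)
    finally show ?thesis .
  qed
  have l1: "integrable lebesgue (\<lambda>x. (q + (p - q) * indicator D x) * ((g x \<bullet> b) * dderiv f b x))" if b: "b \<in> Basis" for b
  proof -
    note lg = weak_grad_component(1)[OF g uc f b]
    have "integrable lebesgue (\<lambda>x. q * ((g x \<bullet> b) * dderiv f b x) + (p - q) * (indicator D x * (g x \<bullet> b) * dderiv f b x))"
      using i1[OF lg, of b] i1[OF lD[OF lg], of b] by simp
    then show ?thesis by (simp add: algebra_simps)
  qed
  have l2: "integrable lebesgue (\<lambda>x. (q * u x + (p - q) * (indicator D x * (u x - d))) * dderiv (dderiv f b) b x)" if b: "b \<in> Basis" for b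
  proof -
    have "integrable lebesgue (\<lambda>x. q * (u x * dderiv (dderiv f b) b x) + (p - q) * (indicator D x * (u x - d) * dderiv (dderiv f b) b x))"
      using i2[OF lu(1) b] i2[OF lD[OF lu(2)] b] by simp
    then show ?thesis by (simp add: algebra_simps)
  qed
  have "(\<integral>x. (if x \<in> D then p else q) * (g x \<bullet> grad f x) \<partial>lebesgue)
    = (\<integral>x. (\<Sum>b\<in>Basis. (q + (p - q) * indicator D x) * ((g x \<bullet> b) * dderiv f b x)) \<partial>lebesgue)"
    by (rule Bochner_Integration.integral_cong)
      (auto simp: grad_def inner_sum_right sum_distrib_left mult_ac)
  also have "\<dots> = (\<Sum>b\<in>Basis. (\<integral>x. (q + (p - q) * indicator D x) * ((g x \<bullet> b) * dderiv f b x) \<partial>lebesgue))"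
    by (rule Bochner_Integration.integral_sum[OF l1])
  also have "\<dots> = - (\<Sum>b\<in>Basis. (\<integral>x. (q * u x + (p - q) * (indicator D x * (u x - d))) * dderiv (dderiv f b) b x \<partial>lebesgue))"
    by (simp add: comp sum_negf)
  also have "(\<Sum>b\<in>Basis. (\<integral>x. (q * u x + (p - q) * (indicator D x * (u x - d))) * dderiv (dderiv f b) b x \<partial>lebesgue))
    = (\<integral>x. (\<Sum>b\<in>Basis. (q * u x + (p - q) * (indicator D x * (u x - d))) * dderiv (dderiv f b) b x) \<partial>lebesgue)"
    by (rule Bochner_Integration.integral_sum[OF l2, symmetric])
  finally show ?thesis by (simp add: laplacian_def sum_distrib_left)
qed

subsection \<open>Comparison principle\<close>

text \<open>Testing only with bumps makes the notion invariant under isometries, and it suffices to make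
  every mollification of \<open>w\<close> classically superharmonic.\<close>

definition weakly_superharmonic :: "('a::euclidean_space \<Rightarrow> real) \<Rightarrow> 'a set \<Rightarrow> bool" where
  "weakly_superharmonic w S \<longleftrightarrow> (\<forall>x e. e > 0 \<and> cball x e \<subseteq> S \<longrightarrow> (\<integral>y. w y * laplacian (bump 0 e x) y \<partial>lebesgue) \<le> 0)"

text \<open>If \<open>c\<close> were negative, \<open>f'\<close> would vanish at the minimum and be
  negative just to the right of it, so \<open>f\<close> would drop below \<open>f 0\<close>.\<close>

lemma second_derivative_nonneg:
  fixes f f' :: "real \<Rightarrow> real"
  assumes r: "r > 0" and f: "\<And>t. \<bar>t\<bar> < r \<Longrightarrow> (f has_real_derivative f' t) (at t)"
    and c: "(f' has_real_derivative c) (at 0)" and min: "\<And>t. \<bar>t\<bar> < r \<Longrightarrow> f 0 \<le> f t"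
  shows "c \<ge> 0"
proof (rule ccontr)
  assume "\<not> c \<ge> 0"
  then have "c < 0" by simp
  have "f' 0 = 0"
    by (rule DERIV_local_min[OF f[of 0] r]) (use r min in auto)
  obtain d where d: "d > 0" "\<And>h. h > 0 \<Longrightarrow> h < d \<Longrightarrow> f' h < 0"
    using DERIV_neg_dec_right[OF c \<open>c < 0\<close>] \<open>f' 0 = 0\<close> by auto
  define h where "h = min d r / 2"
  have h: "0 < h" "h < d" "h < r" using d r by (auto simp: h_def)
  obtain t where "0 < t" "t < h" "f h - f 0 = (h - 0) * f' t"
    using MVT2[of 0 h f f'] f h by auto
  with d(2)[of t] h have "f h < f 0" by (smt (verit) mult_pos_neg)
  then show False using min[of h] h by simp
qed

lemma smooth_directional:
  assumes "smooth_on UNIV f"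
  shows "((\<lambda>t. f (x + t *\<^sub>R b)) has_real_derivative dderiv f b x) (at 0)"
proof -
  have 1: "((\<lambda>t. x + t *\<^sub>R b) has_derivative (\<lambda>s. s *\<^sub>R b)) (at (0::real))"
    by (auto intro!: derivative_eq_intros)
  have 2: "dderiv f (s *\<^sub>R b) x = s * dderiv f b x" for s
    using has_derivative_bounded_linear[OF smooth_has_derivative[OF assms]]
    by (metis linear_simps(5) real_scaleR_def)
  have "((\<lambda>t. f (x + t *\<^sub>R b)) has_derivative (\<lambda>s. dderiv f (s *\<^sub>R b) (x + 0 *\<^sub>R b))) (at 0)"
    by (rule has_derivative_compose[OF 1 smooth_has_derivative[OF assms]])
  then show ?thesis by (simp add: 2 has_field_derivative_def mult_commute_abs)
qed

text \<open>Lets directional derivatives be assumed only at parameter \<open>0\<close>, for every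
  base point, and then used along a whole line.\<close>

lemma directional_shift:
  fixes x b :: "'a::real_vector"
  assumes "((\<lambda>s. f ((x + t *\<^sub>R b) + s *\<^sub>R b)) has_real_derivative c) (at 0)"
  shows "((\<lambda>s. f (x + s *\<^sub>R b)) has_real_derivative c) (at t)"
proof -
  have "(\<lambda>s. f ((x + t *\<^sub>R b) + s *\<^sub>R b)) = (\<lambda>s. (\<lambda>s. f (x + s *\<^sub>R b)) (s + t))"
    by (simp add: scaleR_add_left add_ac)
  with assms show ?thesis using DERIV_shift[of "\<lambda>s. f (x + s *\<^sub>R b)" c 0 t] by simp
qed

text \<open>Links the tested inequality to a classical one: the integral in
  \<open>weakly_superharmonic\<close> is the Laplacian at \<open>x\<close> of the mollified
  function. The Laplacian of the bump depends only on the distance to the centre, so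
  \<open>x - y\<close> may be exchanged for \<open>y\<close> with centre \<open>x\<close>.\<close>

lemma laplacian_conv:
  assumes "locally_integrable w" "e > 0"
  shows "laplacian (\<lambda>x. \<integral>y. w y * bump 0 e 0 (x - y) \<partial>lebesgue) x = (\<integral>y. w y * laplacian (bump 0 e x) y \<partial>lebesgue)"
proof -
  note t = test_fun_bump[OF assms(2), of 0 0]
  have eq: "laplacian (bump 0 e x) y = (\<Sum>b\<in>Basis. dderiv (dderiv (bump 0 e 0) b) b (x - y))" for y
    using laplacian_bump_cong[of x y 0 "x - y" e] by (simp add: laplacian_def dist_norm norm_minus_commute)
  have d1: "dderiv (\<lambda>x. \<integral>y. w y * bump 0 e 0 (x - y) \<partial>lebesgue) b = (\<lambda>x. \<integral>y. w y * dderiv (bump 0 e 0) b (x - y) \<partial>lebesgue)" for b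
    by (rule ext) (rule dderiv_conv[OF assms(1) t])
  show ?thesis
    unfolding laplacian_def[of "\<lambda>x. \<integral>y. w y * bump 0 e 0 (x - y) \<partial>lebesgue"] d1 dderiv_conv[OF assms(1) test_fun_dderiv[OF t]]
      eq sum_distrib_left
    by (rule Bochner_Integration.integral_sum[symmetric]) (rule integrable_conv[OF assms(1) test_fun_dderiv[OF test_fun_dderiv[OF t]]])
qed

text \<open>A weighted mean over points closer than \<open>e\<close>. The rate is explicit and
  uniform in \<open>x\<close>, so one radius serves a whole compact set.\<close>

lemma conv_approx:
  fixes w :: "'a::euclidean_space \<Rightarrow> real"
  assumes L: "L-lipschitz_on UNIV w" and e: "e > 0"
  shows "\<bar>(\<integral>y. w y * bump 0 e 0 (x - y) \<partial>lebesgue) / bump_mass TYPE('a) e - w x\<bar> \<le> L * e"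
proof -
  have w: "locally_integrable w" by (rule continuous_locally_integrable[OF lipschitz_on_continuous_on[OF L]])
  define M where "M = bump_mass TYPE('a) e"
  have M: "M > 0" unfolding M_def by (rule bump_mass_pos[OF e])
  note i1 = integrable_conv[OF w test_fun_bump[OF e, of 0 0], of x, unfolded bump_translate]
  note i2 = bump_integrable[OF e, of 0 x]
  have "\<bar>(\<integral>y. w y * bump 0 e x y \<partial>lebesgue) - w x * M\<bar> = \<bar>\<integral>y. (w y - w x) * bump 0 e x y \<partial>lebesgue\<bar>"
    using i1 i2 by (simp add: left_diff_distrib M_def bump_integral[OF e])
  also have "\<dots> \<le> (\<integral>y. L * e * bump 0 e x y \<partial>lebesgue)"
    unfolding real_norm_def[symmetric]
  proof (rule order_trans[OF integral_norm_bound integral_mono[OF integrable_norm]])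
    show "integrable lebesgue (\<lambda>y. (w y - w x) * bump 0 e x y)" using i1 i2 by (simp add: left_diff_distrib)
    show "integrable lebesgue (\<lambda>y. L * e * bump 0 e x y)" using i2 by simp
    fix y
    show "norm ((w y - w x) * bump 0 e x y) \<le> L * e * bump 0 e x y"
    proof (cases "bump 0 e x y = 0")
      case False
      then have "dist x y < e" by (rule bump_support[OF e])
      have "\<bar>w y - w x\<bar> \<le> L * dist y x" using lipschitz_onD[OF L, of y x] by (simp add: dist_real_def)
      also have "\<dots> \<le> L * e" using \<open>dist x y < e\<close> lipschitz_on_nonneg[OF L]
        by (intro mult_left_mono) (auto simp: dist_commute)
      finally show ?thesis using bump_nonneg[of 0 e x y] by (simp add: abs_mult mult_right_mono)
    qed simp
  qed
  also have "\<dots> = L * e * M" using bump_integral[OF e, of x] by (simp add: M_def)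
  finally have "\<bar>(\<integral>y. w y * bump 0 e x y \<partial>lebesgue) - w x * M\<bar> / M \<le> L * e"
    using M by (simp add: divide_le_eq)
  moreover have "\<bar>(\<integral>y. w y * bump 0 e x y \<partial>lebesgue) - w x * M\<bar> / M = \<bar>(\<integral>y. w y * bump 0 e x y \<partial>lebesgue) / M - w x\<bar>"
  proof -
    have "(\<integral>y. w y * bump 0 e x y \<partial>lebesgue) / M - w x = ((\<integral>y. w y * bump 0 e x y \<partial>lebesgue) - w x * M) / M"
      using M by (simp add: diff_divide_distrib)
    then show ?thesis using M by simp
  qed
  ultimately show ?thesis by (simp add: bump_translate M_def)
qed

text \<open>If \<open>w - q\<close> were negative somewhere, a mollification of \<open>w\<close> minus \<open>q + k \<bar>x\<bar>\<^sup>2\<close> would have an interior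
  minimum, at which its Laplacian is negative.\<close>

lemma comparison_compact:
  fixes w q :: "'a::euclidean_space \<Rightarrow> real"
  assumes S: "open S" and L: "L-lipschitz_on UNIV w" and w: "weakly_superharmonic w S"
    and q1: "\<And>x b. x \<in> S \<Longrightarrow> b \<in> Basis \<Longrightarrow> ((\<lambda>t. q (x + t *\<^sub>R b)) has_real_derivative q' b x) (at 0)"
    and q2: "\<And>x b. x \<in> S \<Longrightarrow> b \<in> Basis \<Longrightarrow> ((\<lambda>t. q' b (x + t *\<^sub>R b)) has_real_derivative q'' b x) (at 0)"
    and sub: "\<And>x. x \<in> S \<Longrightarrow> (\<Sum>b\<in>Basis. q'' b x) \<ge> 0"
    and qc: "continuous_on S q"
    and cpt: "\<And>m. m > 0 \<Longrightarrow> compact {x \<in> S. w x - q x \<le> - m}"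
    and x1: "x1 \<in> S"
  shows "q x1 \<le> w x1"
proof (rule ccontr)
  assume "\<not> q x1 \<le> w x1"
  \<comment> \<open>Half the defect at \<open>x1\<close>: there the difference is
    \<open>- 2 * m\<close>, which leaves room above the level \<open>- m\<close> for the
    perturbations below.\<close>
  define m where "m = (q x1 - w x1) / 2"
  have m: "m > 0" using \<open>\<not> q x1 \<le> w x1\<close> by (simp add: m_def)
  define K where "K = {x \<in> S. w x - q x \<le> - m}"
  have K: "compact K" "K \<subseteq> S" unfolding K_def using cpt[OF m] by auto
  have x1m: "w x1 - q x1 = - 2 * m" by (simp add: m_def)
  have x1K: "x1 \<in> K" "w x1 - q x1 = - 2 * m" using x1 m x1m by (auto simp: K_def)
  have wc: "continuous_on UNIV w" using L by (rule lipschitz_on_continuous_on)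
  note lw = continuous_locally_integrable[OF wc]
  note Lnn = lipschitz_on_nonneg[OF L]
  obtain R where R: "R > 0" "\<And>x. x \<in> K \<Longrightarrow> norm x \<le> R"
    using compact_imp_bounded[OF K(1)] unfolding bounded_pos by blast
  \<comment> \<open>Keeps the quadratic term below \<open>m / 8\<close> on \<open>K\<close>; its
    positive Laplacian supplies the strict inequality at the end.\<close>
  define k where "k = m / (8 * R\<^sup>2)"
  have k: "k > 0" "k * R\<^sup>2 = m / 8" using m R by (auto simp: k_def)
  have kx: "0 \<le> k * (x \<bullet> x)" "k * (x \<bullet> x) \<le> m / 8" if "x \<in> K" for x
  proof -
    have "(norm x)\<^sup>2 \<le> R\<^sup>2" using R(2)[OF that] by (intro power_mono) auto
    then have "x \<bullet> x \<le> R\<^sup>2" by (simp add: power2_norm_eq_inner)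
    then show "k * (x \<bullet> x) \<le> m / 8" unfolding k(2)[symmetric] using k(1) by (intro mult_left_mono) auto
    show "0 \<le> k * (x \<bullet> x)" using k by simp
  qed
  obtain e0 where e0: "e0 > 0" "(\<Union>x\<in>K. cball x e0) \<subseteq> S"
    using compact_subset_open_imp_cball_epsilon_subset[OF K(1) S K(2)] by metis
  \<comment> \<open>The first bound keeps the mollification balls around \<open>K\<close> inside
    \<open>S\<close>, the second makes the mollification error at most \<open>m / 8\<close>;
    \<open>L + 1\<close> avoids division by zero.\<close>
  define e where "e = min e0 (m / (8 * (L + 1)))"
  have e: "e > 0" using e0 m Lnn by (simp add: e_def)
  have eS: "cball x e \<subseteq> S" if "x \<in> K" for x
    using e0(2) that by (fastforce simp: e_def)
  have Le: "L * e \<le> m / 8"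
  proof -
    have "L * e \<le> (L + 1) * (m / (8 * (L + 1)))" using Lnn m e by (intro mult_mono) (auto simp: e_def)
    also have "\<dots> = m / 8" using Lnn by (simp add: divide_simps)
    finally show ?thesis .
  qed
  define M where "M = bump_mass TYPE('a) e"
  have M: "M > 0" unfolding M_def by (rule bump_mass_pos[OF e])
  define c where "c = (\<lambda>x. \<integral>y. w y * bump 0 e 0 (x - y) \<partial>lebesgue)"
  have sc: "smooth_on UNIV c" unfolding c_def by (rule smooth_conv[OF lw test_fun_bump[OF e]])
  have approx: "\<bar>c x / M - w x\<bar> \<le> m / 8" for x
    using conv_approx[OF L e, of x] Le unfolding c_def M_def by linarith
  have lc: "laplacian c x \<le> 0" if "x \<in> K" for x
    using w e eS[OF that] laplacian_conv[OF lw e, of x] unfolding weakly_superharmonic_def c_def by auto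
  define p where "p = (\<lambda>x. c x / M - q x - k * (x \<bullet> x))"
  have "continuous_on K p" unfolding p_def
    by (intro continuous_intros smooth_continuous[OF sc] continuous_on_subset[OF qc K(2)]) (use M in auto)
  from continuous_attains_inf[OF K(1) _ this] x1K(1)
  obtain x where x: "x \<in> K" "\<And>y. y \<in> K \<Longrightarrow> p x \<le> p y" by auto
  have "p x \<le> p x1" using x x1K by blast
  \<comment> \<open>Two mollification errors and one quadratic term cost at most
    \<open>3 * m / 8\<close> against \<open>- 2 * m\<close>. The minimiser thus lies strictly below
    the level defining \<open>K\<close>, and a ball around it stays in \<open>K\<close>.\<close>
  then have "w x - q x < - m"
    using approx[of x] approx[of x1] kx[OF x(1)] kx[OF x1K(1)] x1K(2) m unfolding p_def by linarith
  have xS: "x \<in> S" using x K by blast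
  have "continuous_on S (\<lambda>x. w x - q x)"
    by (intro continuous_intros qc continuous_on_subset[OF wc]) auto
  then have "open (S \<inter> (\<lambda>x. w x - q x) -` {..< - m})"
    by (rule continuous_open_preimage[OF _ S]) simp
  moreover have "S \<inter> (\<lambda>x. w x - q x) -` {..< - m} = {y \<in> S. w y - q y < - m}" by auto
  ultimately have "open {y \<in> S. w y - q y < - m}" by simp
  moreover have "x \<in> {y \<in> S. w y - q y < - m}" using \<open>w x - q x < - m\<close> xS by simp
  ultimately obtain r where r: "r > 0" "ball x r \<subseteq> {y \<in> S. w y - q y < - m}"
    by (rule openE)
  then have rK: "ball x r \<subseteq> K" by (force simp: K_def)
  have "0 \<le> dderiv (dderiv c b) b x / M - q'' b x - 2 * k" if b: "b \<in> Basis" for b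
  proof (rule second_derivative_nonneg[OF r(1)])
    have tK: "x + t *\<^sub>R b \<in> K" if "\<bar>t\<bar> < r" for t
      using rK that b by (auto simp: dist_norm)
    show "p (x + 0 *\<^sub>R b) \<le> p (x + t *\<^sub>R b)" if "\<bar>t\<bar> < r" for t
      using x(2)[OF tK[OF that]] by simp
    show "((\<lambda>t. p (x + t *\<^sub>R b)) has_real_derivative
        dderiv c b (x + t *\<^sub>R b) / M - q' b (x + t *\<^sub>R b) - 2 * k * ((x + t *\<^sub>R b) \<bullet> b)) (at t)" if t: "\<bar>t\<bar> < r" for t
    proof -
      have "x + t *\<^sub>R b \<in> S" using tK[OF t] K(2) by blast
      note 1 = directional_shift[where f=q, OF q1[OF this b]]
      note 2 = directional_shift[where f=c, OF smooth_directional[OF sc]]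
      have 3: "((\<lambda>t. (x + t *\<^sub>R b) \<bullet> (x + t *\<^sub>R b)) has_real_derivative 2 * ((x + t *\<^sub>R b) \<bullet> b)) (at t)"
        using b unfolding inner_add_left inner_add_right inner_scaleR_left inner_scaleR_right
        by (auto intro!: derivative_eq_intros simp: inner_commute)
      show ?thesis unfolding p_def
        by (rule derivative_eq_intros 1 2 3 refl | use M in simp)+
    qed
    have 3: "((\<lambda>t. (x + t *\<^sub>R b) \<bullet> b) has_real_derivative 1) (at 0)"
      using b unfolding inner_add_left inner_scaleR_left by (auto intro!: derivative_eq_intros)
    show "((\<lambda>t. dderiv c b (x + t *\<^sub>R b) / M - q' b (x + t *\<^sub>R b) - 2 * k * ((x + t *\<^sub>R b) \<bullet> b)) has_real_derivative
        dderiv (dderiv c b) b x / M - q'' b x - 2 * k) (at 0)"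
      by (rule derivative_eq_intros smooth_directional[OF smooth_dderiv[OF sc]] q2[OF xS b] 3 refl | use M in simp)+
  qed
  then have "0 \<le> (\<Sum>b\<in>Basis. dderiv (dderiv c b) b x / M - q'' b x - 2 * k)" by (rule sum_nonneg)
  also have "\<dots> = laplacian c x / M - (\<Sum>b\<in>Basis. q'' b x) - DIM('a) * (2 * k)"
    by (simp add: sum_subtractf laplacian_def sum_divide_distrib)
  also have "\<dots> < 0"
  proof -
    have "laplacian c x / M \<le> 0" using lc[OF x(1)] M by (simp add: divide_le_0_iff)
    moreover have "real DIM('a) * (2 * k) > 0" using k by simp
    ultimately show ?thesis using sub[OF xS] by linarith
  qed
  finally show False by simp
qed

text \<open>The frontier inequality makes the set where \<open>w - q \<le> - m\<close> closed, since
  none of its limit points can lie on the frontier; the condition at infinity makes it bounded. This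
  is the compactness required by \<open>comparison_compact\<close>.\<close>

lemma comparison:
  fixes w q :: "'a::euclidean_space \<Rightarrow> real"
  assumes S: "open S" and L: "L-lipschitz_on UNIV w" and w: "weakly_superharmonic w S"
    and q1: "\<And>x b. x \<in> S \<Longrightarrow> b \<in> Basis \<Longrightarrow> ((\<lambda>t. q (x + t *\<^sub>R b)) has_real_derivative q' b x) (at 0)"
    and q2: "\<And>x b. x \<in> S \<Longrightarrow> b \<in> Basis \<Longrightarrow> ((\<lambda>t. q' b (x + t *\<^sub>R b)) has_real_derivative q'' b x) (at 0)"
    and sub: "\<And>x. x \<in> S \<Longrightarrow> (\<Sum>b\<in>Basis. q'' b x) \<ge> 0"
    and qc: "continuous_on (closure S) q"
    and fr: "\<And>x. x \<in> frontier S \<Longrightarrow> q x \<le> w x"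
    and inf: "\<And>m. m > 0 \<Longrightarrow> \<exists>R. \<forall>x\<in>S. norm x > R \<longrightarrow> w x - q x > - m"
    and x1: "x1 \<in> S"
  shows "q x1 \<le> w x1"
proof (rule comparison_compact[OF S L w q1 q2 sub continuous_on_subset[OF qc closure_subset] _ x1])
  fix m :: real assume m: "m > 0"
  have wc: "continuous_on UNIV w" using L by (rule lipschitz_on_continuous_on)
  have cl: "closure S = S \<union> frontier S" using closure_Un_frontier by blast
  have eq: "{x \<in> S. w x - q x \<le> - m} = closure S \<inter> (\<lambda>x. w x - q x) -` {.. - m}"
    using fr m unfolding cl by (fastforce simp: )
  have "closed {x \<in> S. w x - q x \<le> - m}"
    unfolding eq by (intro continuous_closed_preimage continuous_intros continuous_on_subset[OF wc] qc) auto
  moreover obtain R where "\<forall>x\<in>S. norm x > R \<longrightarrow> w x - q x > - m" using inf[OF m] by blast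
  then have "bounded {x \<in> S. w x - q x \<le> - m}"
    unfolding bounded_iff by (intro exI[of _ R]) (auto simp: not_less[symmetric])
  ultimately show "compact {x \<in> S. w x - q x \<le> - m}" by (simp add: compact_eq_bounded_closed)
qed auto

lemma comparison_const:
  fixes w :: "'a::euclidean_space \<Rightarrow> real"
  assumes "open S" "L-lipschitz_on UNIV w" "weakly_superharmonic w S"
    and "\<And>x. x \<in> frontier S \<Longrightarrow> c \<le> w x"
    and "\<And>m. m > 0 \<Longrightarrow> \<exists>R. \<forall>x\<in>S. norm x > R \<longrightarrow> w x - c > - m"
    and "x \<in> S"
  shows "c \<le> w x"
  by (rule comparison[OF assms(1-3), where q="\<lambda>_. c" and q'="\<lambda>_ _. 0" and q''="\<lambda>_ _. 0"])
    (use assms in auto)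

text \<open>A multiple of the norm to the power 2 - N, written through the squared norm to make the
  directional derivatives a one-variable chain rule. Positive \<open>c\<close> gives barriers from
  below for \<open>v\<close>, negative \<open>c\<close> those for \<open>- v\<close>.\<close>

definition fund_sol :: "real \<Rightarrow> 'a::euclidean_space \<Rightarrow> real" where
  "fund_sol c x = c * (x \<bullet> x) powr ((2 - real DIM('a)) / 2)"

lemma directional_norm_powr:
  fixes x :: "'a::euclidean_space"
  assumes "x \<noteq> 0"
  shows "((\<lambda>t. ((x + t *\<^sub>R b) \<bullet> (x + t *\<^sub>R b)) powr s) has_real_derivative 2 * s * (x \<bullet> b) * (x \<bullet> x) powr (s - 1)) (at 0)"
proof -
  have 3: "((\<lambda>t. (x + t *\<^sub>R b) \<bullet> (x + t *\<^sub>R b)) has_real_derivative 2 * (x \<bullet> b)) (at 0)"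
    unfolding inner_add_left inner_add_right inner_scaleR_left inner_scaleR_right
    by (auto intro!: derivative_eq_intros simp: inner_commute)
  have "((\<lambda>y. y powr s) has_real_derivative s * (x \<bullet> x) powr (s - 1)) (at ((x + 0 *\<^sub>R b) \<bullet> (x + 0 *\<^sub>R b)))"
    using assms has_real_derivative_powr[of "x \<bullet> x" s] by simp
  from DERIV_chain2[OF this 3] show ?thesis by (simp add: mult_ac)
qed

text \<open>Away from the origin \<open>fund_sol c\<close> is harmonic, and it vanishes at infinity
  because the exponent is negative in dimension at least 3; hence only the frontier has to be
  checked.\<close>

lemma comparison_fund_sol:
  fixes w :: "'a::euclidean_space \<Rightarrow> real"
  assumes dim: "DIM('a) \<ge> 3" and S: "open S" "0 \<notin> closure S" and w: "L-lipschitz_on UNIV w" "weakly_superharmonic w S"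
    and fr: "\<And>x. x \<in> frontier S \<Longrightarrow> fund_sol c x \<le> w x"
    and inf: "(w \<longlongrightarrow> 0) at_infinity"
    and x: "x \<in> S"
  shows "fund_sol c x \<le> w x"
proof -
  define s where "s = (2 - real DIM('a)) / 2"
  have s: "s < 0" using dim by (simp add: s_def)
  have fund_sol: "fund_sol c = (\<lambda>x::'a. c * (x \<bullet> x) powr s)" by (simp add: fund_sol_def[abs_def] s_def)
  have nz: "x \<noteq> 0" if "x \<in> closure S" for x using S that by blast
  have nzS: "x \<noteq> 0" if "x \<in> S" for x using nz closure_subset that by blast
  define q' where "q' b x = c * (2 * s * (x \<bullet> b) * (x \<bullet> x) powr (s - 1))" for b x :: 'a
  define q'' where "q'' b x = c * (2 * s * ((x \<bullet> x) powr (s - 1) + (x \<bullet> b) * (2 * (s - 1) * (x \<bullet> b) * (x \<bullet> x) powr (s - 1 - 1))))" for b x :: 'a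
  show ?thesis
  proof (rule comparison[OF S(1) w, where q="fund_sol c" and q'=q' and q''=q''])
    fix x b :: 'a assume xb: "x \<in> S" "b \<in> Basis"
    show "((\<lambda>t. fund_sol c (x + t *\<^sub>R b)) has_real_derivative q' b x) (at 0)"
      unfolding fund_sol q'_def by (intro DERIV_cmult directional_norm_powr nzS xb)
    have 1: "((\<lambda>t. (x + t *\<^sub>R b) \<bullet> b) has_real_derivative 1) (at 0)"
      using xb unfolding inner_add_left inner_scaleR_left by (auto intro!: derivative_eq_intros)
    show "((\<lambda>t. q' b (x + t *\<^sub>R b)) has_real_derivative q'' b x) (at 0)"
      using DERIV_cmult[OF DERIV_mult[OF DERIV_cmult[OF 1, of "2 * s"] directional_norm_powr[OF nzS[OF xb(1)], of b "s - 1"]], of c]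
      unfolding q'_def q''_def by (simp add: algebra_simps)
  next
    fix x :: 'a assume x: "x \<in> S"
    define r where "r = x \<bullet> x"
    have r: "r > 0" using nzS[OF x] by (simp add: r_def)
    have pr: "r powr (s - 1) = r * r powr (s - 1 - 1)" 
      using r powr_mult_base[of r "s - 1 - 1"] by simp
    have "(\<Sum>b\<in>Basis. q'' b x) = (\<Sum>b\<in>Basis. c * (2 * s * r powr (s - 1)) + c * (2 * s * (2 * (s - 1)) * r powr (s - 1 - 1)) * ((x \<bullet> b) * (x \<bullet> b)))"
      unfolding q''_def r_def[symmetric] by (rule sum.cong) (auto simp: algebra_simps)
    also have "\<dots> = DIM('a) * (c * (2 * s * r powr (s - 1))) + c * (2 * s * (2 * (s - 1)) * r powr (s - 1 - 1)) * r"
      unfolding sum.distrib sum_distrib_left[symmetric] euclidean_inner[of x x, symmetric] r_def by simp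
    also have "\<dots> = c * 2 * s * r powr (s - 1) * (DIM('a) + 2 * (s - 1))"
      unfolding pr by (simp add: algebra_simps)
    \<comment> \<open>The exponent is the one for which
      \<open>2 * (s - 1) = - DIM('a)\<close>.\<close>
    also have "\<dots> = 0" by (simp add: s_def field_simps)
    finally show "(\<Sum>b\<in>Basis. q'' b x) \<ge> 0" by simp
  next
    show "continuous_on (closure S) (fund_sol c)"
      unfolding fund_sol using nz by (intro continuous_intros) auto
  next
    fix m :: real assume m: "m > 0"
    have "((\<lambda>x::'a. (x \<bullet> x) powr s) \<longlongrightarrow> 0) at_infinity"
    proof -
      have "filterlim (\<lambda>x::'a. x \<bullet> x) at_top at_infinity"
        unfolding power2_norm_eq_inner[symmetric]
        by (intro filterlim_pow_at_top filterlim_norm_at_top) simp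
      then show ?thesis using tendsto_neg_powr[OF s, of "\<lambda>x::'a. x \<bullet> x"] by simp
    qed
    then have "((\<lambda>x. w x - fund_sol c x) \<longlongrightarrow> 0 - c * 0) at_infinity"
      unfolding fund_sol by (intro tendsto_intros inf)
    then have "eventually (\<lambda>x. w x - fund_sol c x > - m) at_infinity"
      using m by (auto dest!: order_tendstoD(1)[of _ _ _ "- m"])
    then show "\<exists>R. \<forall>x\<in>S. norm x > R \<longrightarrow> w x - fund_sol c x > - m"
      unfolding eventually_at_infinity by (meson less_imp_le)
  qed (use fr x in auto)
qed

subsection \<open>Orthogonal invariance\<close>

text \<open>The Fubini argument for uniqueness of Haar measure; taking the unit ball for one of the two
  functions yields invariance of Lebesgue measure.\<close>

lemma nn_integral_orthogonal_symmetric: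
  fixes R :: "'a::euclidean_space \<Rightarrow> 'a" and f g :: "'a \<Rightarrow> ennreal"
  assumes R: "orthogonal_transformation R"
    and f: "f \<in> borel_measurable borel" and g: "g \<in> borel_measurable borel"
  shows "(\<integral>\<^sup>+x. f (R x) \<partial>lborel) * (\<integral>\<^sup>+y. g y \<partial>lborel) = (\<integral>\<^sup>+x. g (R x) \<partial>lborel) * (\<integral>\<^sup>+y. f y \<partial>lborel)"
proof -
  have lin: "linear R" using R by (simp add: orthogonal_transformation_linear)
  have [measurable]: "R \<in> borel_measurable borel"
    using lin by (intro borel_measurable_continuous_onI linear_continuous_on linear_conv_bounded_linear[THEN iffD1])
  note f[measurable] g[measurable]
  have tr: "(\<integral>\<^sup>+y. h (c + y) \<partial>lborel) = (\<integral>\<^sup>+y. h y \<partial>lborel)"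
    if [measurable]: "h \<in> borel_measurable borel" for h :: "'a \<Rightarrow> ennreal" and c
  proof -
    have "(\<integral>\<^sup>+y. h y \<partial>lborel) = (\<integral>\<^sup>+y. h y \<partial>distr lborel borel ((+) c))" by (simp add: lborel_distr_plus)
    then show ?thesis by (simp add: nn_integral_distr)
  qed
  have rf: "(\<integral>\<^sup>+y. h (c - y) \<partial>lborel) = (\<integral>\<^sup>+y. h y \<partial>lborel)"
    if [measurable]: "h \<in> borel_measurable borel" for h :: "'a \<Rightarrow> ennreal" and c
  proof -
    have "lborel = distr lborel borel (\<lambda>y. c - y)" using lborel_affine[of "-1" c] by (simp add: density_1)
    then have "(\<integral>\<^sup>+y. h y \<partial>lborel) = (\<integral>\<^sup>+y. h y \<partial>distr lborel borel (\<lambda>y. c - y))" by simp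
    then show ?thesis by (simp add: nn_integral_distr)
  qed
  have "(\<integral>\<^sup>+x. f (R x) \<partial>lborel) * (\<integral>\<^sup>+y. g y \<partial>lborel) = (\<integral>\<^sup>+x. f (R x) * (\<integral>\<^sup>+y. g (R x + y) \<partial>lborel) \<partial>lborel)"
    by (simp add: tr nn_integral_multc)
  also have "\<dots> = (\<integral>\<^sup>+x. (\<integral>\<^sup>+y. f (R x) * g (R x + y) \<partial>lborel) \<partial>lborel)"
    by (simp add: nn_integral_cmult)
  also have "\<dots> = (\<integral>\<^sup>+y. (\<integral>\<^sup>+x. f (R x) * g (R x + y) \<partial>lborel) \<partial>lborel)"
    by (rule lborel_pair.Fubini'[symmetric]) measurable
  also have "\<dots> = (\<integral>\<^sup>+y. (\<integral>\<^sup>+x. f (R x - y) * g (R x) \<partial>lborel) \<partial>lborel)"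
  proof (rule nn_integral_cong)
    fix y :: 'a
    \<comment> \<open>Translating \<open>x\<close> by the preimage of \<open>- y\<close> moves the
      shift from the argument of \<open>g\<close> to that of \<open>f\<close>.\<close>
    obtain z where z: "R z = - y"
      using orthogonal_transformation_surj[OF R] by (metis surjD)
    have "(\<integral>\<^sup>+x. f (R x) * g (R x + y) \<partial>lborel) = (\<integral>\<^sup>+x. f (R (z + x)) * g (R (z + x) + y) \<partial>lborel)"
      by (rule tr[symmetric]) measurable
    then show "(\<integral>\<^sup>+x. f (R x) * g (R x + y) \<partial>lborel) = (\<integral>\<^sup>+x. f (R x - y) * g (R x) \<partial>lborel)"
      by (simp add: linear_add[OF lin] z)
  qed
  also have "\<dots> = (\<integral>\<^sup>+x. (\<integral>\<^sup>+y. f (R x - y) * g (R x) \<partial>lborel) \<partial>lborel)"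
    by (rule lborel_pair.Fubini') measurable
  also have "\<dots> = (\<integral>\<^sup>+x. (\<integral>\<^sup>+y. f (R x - y) \<partial>lborel) * g (R x) \<partial>lborel)"
    by (simp add: nn_integral_multc)
  also have "\<dots> = (\<integral>\<^sup>+x. g (R x) \<partial>lborel) * (\<integral>\<^sup>+y. f y \<partial>lborel)"
    by (simp add: rf nn_integral_cmult mult.commute)
  finally show ?thesis .
qed

lemma lborel_distr_orthogonal:
  fixes R :: "'a::euclidean_space \<Rightarrow> 'a"
  assumes R: "orthogonal_transformation R"
  shows "distr lborel borel R = lborel"
proof (rule measure_eqI)
  have lin: "linear R" using R by (simp add: orthogonal_transformation_linear)
  have m[measurable]: "R \<in> borel_measurable borel"
    using lin by (intro borel_measurable_continuous_onI linear_continuous_on linear_conv_bounded_linear[THEN iffD1])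
  fix A assume "A \<in> sets (distr lborel borel R)"
  then have A[measurable]: "A \<in> sets borel" by simp
  define B where "B = ball (0::'a) 1"
  have B[measurable]: "B \<in> sets borel" by (simp add: B_def)
  have "(indicator B (R x) :: ennreal) = indicator B x" for x
    using orthogonal_transformation_norm[OF R] by (auto simp: B_def indicator_def)
  then have "(\<integral>\<^sup>+x. indicator A (R x) \<partial>lborel) * emeasure lborel B = emeasure lborel B * emeasure lborel A"
    using nn_integral_orthogonal_symmetric[OF R, of "indicator A" "indicator B"] by simp
  moreover have "emeasure lborel B \<noteq> \<infinity>" "emeasure lborel B \<noteq> 0"
    using emeasure_lborel_ball_finite[of "0::'a" 1] content_ball_pos[of 1 "0::'a"]
    by (auto simp: B_def measure_def)
  ultimately have "(\<integral>\<^sup>+x. indicator A (R x) \<partial>lborel) = emeasure lborel A"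
    by (simp add: mult.commute[of _ "emeasure lborel B"] ennreal_mult_cancel_left)
  moreover have "(\<integral>\<^sup>+x. indicator A (R x) \<partial>lborel) = (\<integral>\<^sup>+x. indicator A x \<partial>distr lborel borel R)"
    by (rule nn_integral_distr[symmetric]) measurable
  ultimately show "emeasure (distr lborel borel R) A = emeasure lborel A" by simp
qed simp

lemma integral_orthogonal:
  fixes R :: "'a::euclidean_space \<Rightarrow> 'a" and f :: "'a \<Rightarrow> real"
  assumes R: "orthogonal_transformation R" and f: "f \<in> borel_measurable borel"
  shows "(\<integral>y. f (R y) \<partial>lebesgue) = integral\<^sup>L lebesgue f"
proof -
  have lin: "linear R" using R by (simp add: orthogonal_transformation_linear)
  have m: "R \<in> borel_measurable borel"
    using lin by (intro borel_measurable_continuous_onI linear_continuous_on linear_conv_bounded_linear[THEN iffD1])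
  have "integral\<^sup>L lborel f = integral\<^sup>L (distr lborel borel R) f" by (simp add: lborel_distr_orthogonal[OF R])
  also have "\<dots> = (\<integral>y. f (R y) \<partial>lborel)" using m f by (simp add: integral_distr)
  finally show ?thesis using f measurable_compose[OF m f] by (simp add: integral_completion)
qed

text \<open>The Laplacian of a bump depends only on the distance to its centre, so \<open>R\<close>
  carries the test centred at \<open>x\<close> to the test centred at \<open>R x\<close>.\<close>

lemma weakly_superharmonic_orthogonal:
  fixes R :: "'a::euclidean_space \<Rightarrow> 'a"
  assumes R: "orthogonal_transformation R" and w: "weakly_superharmonic w UNIV" "continuous_on UNIV w"
  shows "weakly_superharmonic (\<lambda>x. w (R x)) UNIV"
  unfolding weakly_superharmonic_def
proof (intro allI impI)
  fix x :: 'a and e :: real assume e: "0 < e \<and> cball x e \<subseteq> UNIV"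
  have "dist (R a) (R b) = dist a b" for a b
    using R by (metis dist_norm linear_diff orthogonal_transformation_linear orthogonal_transformation_norm)
  then have "laplacian (bump 0 e (R x)) (R y) = laplacian (bump 0 e x) y" for y by (intro laplacian_bump_cong)
  then have "(\<integral>y. w (R y) * laplacian (bump 0 e x) y \<partial>lebesgue) = (\<integral>y. (\<lambda>z. w z * laplacian (bump 0 e (R x)) z) (R y) \<partial>lebesgue)" by simp
  also have "\<dots> = (\<integral>y. w y * laplacian (bump 0 e (R x)) y \<partial>lebesgue)"
    using w(2) test_fun_laplacian[OF test_fun_bump, of e 0 "R x"] e
    by (intro integral_orthogonal[OF R] borel_measurable_continuous_onI continuous_intros) auto
  also have "\<dots> \<le> 0" using w(1) e by (simp add: weakly_superharmonic_def)
  finally show "(\<integral>y. w (R y) * laplacian (bump 0 e x) y \<partial>lebesgue) \<le> 0" .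
qed

lemma exists_orthogonal_swap:
  fixes x y :: "'a::euclidean_space"
  assumes "norm x = norm y"
  obtains R where "orthogonal_transformation R" "R x = y"
proof (cases "x = y")
  case True
  then show ?thesis using that[of "\<lambda>x. x"] by simp
next
  case False
  define z where "z = x - y"
  have z: "z \<bullet> z \<noteq> 0" using False by (simp add: z_def)
  \<comment> \<open>The reflection in the hyperplane orthogonal to \<open>z\<close>. Equal norms
    give \<open>2 * (x \<bullet> z) = z \<bullet> z\<close>, so \<open>x\<close> goes to
    \<open>x - z = y\<close>.\<close>
  define R where "R v = v - (2 * (v \<bullet> z) / (z \<bullet> z)) *\<^sub>R z" for v
  have "linear R" unfolding R_def[abs_def]
    by (rule linearI) (auto simp: inner_add_left scaleR_add_left add_divide_distrib distrib_left scaleR_diff_right)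
  moreover have "R v \<bullet> R w = v \<bullet> w" for v w
    using z by (simp add: R_def inner_diff_left inner_diff_right inner_commute field_simps)
  ultimately have "orthogonal_transformation R" by (simp add: orthogonal_transformation_def)
  moreover have "R x = y"
  proof -
    have "x \<bullet> x = y \<bullet> y" using assms by (metis power2_norm_eq_inner)
    then have "2 * (x \<bullet> z) = z \<bullet> z" by (simp add: z_def inner_diff_left inner_diff_right inner_commute)
    then show ?thesis using z by (simp add: R_def) (simp add: z_def)
  qed
  ultimately show ?thesis by (rule that)
qed

subsection \<open>Domains with spherical boundary\<close>

text \<open>Following the ray from \<open>x\<close> away from the origin, one must leave the bounded
  set through a frontier point at least as far out as \<open>x\<close>.\<close>

lemma outside_bounded_frontier:
  fixes D :: "'a::euclidean_space set"
  assumes "bounded D" "\<And>y. y \<in> frontier D \<Longrightarrow> norm y \<le> r" "r \<ge> 0" "x \<in> D"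
  shows "norm x \<le> r"
proof (rule ccontr)
  assume "\<not> norm x \<le> r"
  then have x: "norm x > r" by simp
  obtain B where B: "\<And>y. y \<in> D \<Longrightarrow> norm y \<le> B" using assms(1) unfolding bounded_iff by blast
  \<comment> \<open>Chosen so that the norm of \<open>t *\<^sub>R x\<close> is
    \<open>B + norm x\<close>, beyond the bound \<open>B\<close>.\<close>
  define t where "t = B / norm x + 1"
  have nx: "norm x > 0" using x assms(3) by linarith
  have Bx: "norm x \<le> B" using B assms(4) by blast
  then have "0 \<le> B" using nx by linarith
  then have t: "t \<ge> 1" "t * norm x > B" using nx by (auto simp: t_def field_simps)
  define z where "z = t *\<^sub>R x"
  have "z \<notin> D" using B[of z] t by (auto simp: z_def)
  then have "closed_segment x z \<inter> frontier D \<noteq> {}"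
    using assms(4) by (intro connected_Int_frontier) auto
  then obtain y where y: "y \<in> closed_segment x z" "y \<in> frontier D" by blast
  obtain s where s: "0 \<le> s" "s \<le> 1" "y = (1 - s) *\<^sub>R x + s *\<^sub>R z"
    using y(1) unfolding closed_segment_def by blast
  have "y = (1 + s * (t - 1)) *\<^sub>R x" by (simp add: s(3) z_def algebra_simps)
  moreover have "s * (t - 1) \<ge> 0" using s t by simp
  ultimately have "norm y \<ge> norm x" using nx by (simp add: distrib_right)
  then show False using assms(2)[OF y(2)] x by linarith
qed

text \<open>The open ball is connected, meets \<open>D\<close> at 0 and misses the frontier, so it
  lies in \<open>D\<close>. Conversely norms in \<open>D\<close> are at most \<open>r\<close>, and
  openness excludes the value \<open>r\<close>, as such a point could be pushed outwards within
  \<open>D\<close>.\<close>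

lemma spherical_frontier_imp_ball:
  fixes D :: "'a::euclidean_space set"
  assumes D: "open D" "bounded D" "0 \<in> D" and r: "r > 0" "\<And>y. y \<in> frontier D \<Longrightarrow> norm y = r"
  shows "D = ball 0 r"
proof
  show "ball 0 r \<subseteq> D"
  proof (rule ccontr)
    assume "\<not> ball 0 r \<subseteq> D"
    moreover have "0 \<in> ball 0 r \<inter> D" using D(3) r(1) by simp
    ultimately have "ball 0 r \<inter> frontier D \<noteq> {}"
      by (intro connected_Int_frontier) blast+
    then show False using r by force
  qed
  show "D \<subseteq> ball 0 r"
  proof
    fix x assume x: "x \<in> D"
    have le: "norm y \<le> r" if "y \<in> D" for y
      by (rule outside_bounded_frontier[OF D(2) _ _ that]) (use r in auto)
    have "norm x \<noteq> r"
    proof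
      assume nx: "norm x = r"
      obtain e where e: "e > 0" "cball x e \<subseteq> D" using D(1) x open_contains_cball by blast
      define y where "y = (1 + e / r) *\<^sub>R x"
      have "y - x = (e / r) *\<^sub>R x" by (simp add: y_def algebra_simps)
      then have "dist x y = e" using e r nx by (simp add: dist_norm norm_minus_commute[of x])
      then have "norm y \<le> r" using e le by (auto simp: subset_iff)
      moreover have "norm y = r + e" using e r nx by (simp add: y_def field_simps)
      ultimately show False using e by simp
    qed
    then show "x \<in> ball 0 r" using le[OF x] by simp
  qed
qed

subsection \<open>The overdetermined obstacle problem\<close>

locale overdetermined_obstacle =
  fixes D :: "'a::euclidean_space set" and p q d L :: real and \<psi> u v :: "'a \<Rightarrow> real"
  assumes dim: "DIM('a) \<ge> 3"
    and D: "open D" "bounded D" "0 \<in> D"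
    and pq: "p > 0" "q > 0"
    and psi_cont: "continuous_on UNIV \<psi>"
    and psi_rad: "\<And>x y. norm x = norm y \<Longrightarrow> \<psi> x = \<psi> y"
    and psi_supp: "\<And>x. \<psi> x > 0 \<Longrightarrow> x \<in> D"
    and u_lip: "L-lipschitz_on UNIV u"
    and u_sol: "obstacle_solution (\<lambda>x. if x \<in> D then p else q) \<psi> u"
    and u_inf: "(u \<longlongrightarrow> 0) at_infinity"
    and d: "d > 0"
    and u_bdry: "\<And>x. x \<in> frontier D \<Longrightarrow> u x = d"
  defines "v \<equiv> \<lambda>x. q * u x + (p - q) * (indicator D x * (u x - d))"
begin

lemma D_ne_UNIV: "D \<noteq> UNIV"
  using D(2) not_bounded_UNIV by blast

lemma frontier_notin: "x \<in> frontier D \<Longrightarrow> x \<notin> D"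
  using D(1) by (simp add: frontier_def interior_open)

lemma v_in: "x \<in> D \<Longrightarrow> v x = p * u x - (p - q) * d"
  by (simp add: v_def algebra_simps)

lemma v_out: "x \<notin> D \<Longrightarrow> v x = q * u x"
  by (simp add: v_def)

lemma psi_le: "\<psi> x \<le> u x"
  using u_sol by (simp add: obstacle_solution_def)

lemma u_cont: "continuous_on UNIV u"
  using u_lip by (rule lipschitz_on_continuous_on)

definition K where "K = q * L + \<bar>p - q\<bar> * L"

text \<open>The truncated function \<open>indicator D * (u - d)\<close> keeps the Lipschitz constant
  of \<open>u\<close>: for points on opposite sides, \<open>lipschitz_to_frontier\<close>
  applies.\<close>

lemma v_lip: "K-lipschitz_on UNIV v"
proof (rule lipschitz_onI)
  have L: "L \<ge> 0" using u_lip by (rule lipschitz_on_nonneg)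
  show "0 \<le> K" using L pq by (simp add: K_def)
  define f where "f x = indicator D x * (u x - d)" for x
  have fr: "\<forall>x\<in>frontier D. u x = d" using u_bdry by blast
  have u: "\<bar>u x - u y\<bar> \<le> L * dist x y" for x y
    using lipschitz_onD[OF u_lip, of x y] by (simp add: dist_real_def)
  have f: "\<bar>f x - f y\<bar> \<le> L * dist x y" for x y
    using u[of x y] lipschitz_to_frontier[OF u_lip fr, of x y] lipschitz_to_frontier[OF u_lip fr, of y x] L
    by (cases "x \<in> D"; cases "y \<in> D") (auto simp: f_def dist_commute abs_minus_commute)
  fix x y :: 'a
  have "\<bar>v x - v y\<bar> = \<bar>q * (u x - u y) + (p - q) * (f x - f y)\<bar>"
    by (simp add: v_def f_def algebra_simps)
  also have "\<dots> \<le> \<bar>q\<bar> * \<bar>u x - u y\<bar> + \<bar>p - q\<bar> * \<bar>f x - f y\<bar>"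
    by (simp add: abs_mult[symmetric] abs_triangle_ineq)
  also have "\<dots> \<le> \<bar>q\<bar> * (L * dist x y) + \<bar>p - q\<bar> * (L * dist x y)"
    by (intro add_mono mult_left_mono u f) auto
  also have "\<dots> = K * dist x y" using pq by (simp add: K_def algebra_simps)
  finally show "dist (v x) (v y) \<le> K * dist x y" by (simp add: dist_real_def)
qed

lemma v_cont: "continuous_on UNIV v"
  using v_lip by (rule lipschitz_on_continuous_on)

text \<open>By the transmission identity the integral is minus the flux tested with the bump, so the
  sign is reversed. In the second claim the closed ball contains the support of the bump.\<close>

lemma v_laplacian:
  assumes "e > 0"
  shows "(\<integral>y. v y * laplacian (bump 0 e x) y \<partial>lebesgue) \<le> 0"
    and "cball x e \<subseteq> {x. u x > \<psi> x} \<Longrightarrow> (\<integral>y. v y * laplacian (bump 0 e x) y \<partial>lebesgue) = 0"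
proof -
  obtain g where g: "weak_grad u g"
    "\<And>f. test_fun f \<Longrightarrow> (\<forall>x. f x \<ge> 0) \<Longrightarrow> (\<integral>x. (if x \<in> D then p else q) * (g x \<bullet> grad f x) \<partial>lebesgue) \<ge> 0"
    "\<And>f. test_fun f \<Longrightarrow> tsupport f \<subseteq> {x. u x > \<psi> x} \<Longrightarrow> (\<integral>x. (if x \<in> D then p else q) * (g x \<bullet> grad f x) \<partial>lebesgue) = 0"
    using u_sol unfolding obstacle_solution_def by blast
  note t = test_fun_bump[OF assms, of 0 x]
  have fr: "\<forall>x\<in>frontier D. u x = d" using u_bdry by blast
  have eq: "(\<integral>y. v y * laplacian (bump 0 e x) y \<partial>lebesgue) = - (\<integral>y. (if y \<in> D then p else q) * (g y \<bullet> grad (bump 0 e x) y) \<partial>lebesgue)"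
    unfolding v_def using transmission_identity[OF g(1) u_lip t D(1) D_ne_UNIV fr, of p q] by simp
  show "(\<integral>y. v y * laplacian (bump 0 e x) y \<partial>lebesgue) \<le> 0"
    unfolding eq using g(2)[OF t] bump_nonneg[of 0 e x] by simp
  show "(\<integral>y. v y * laplacian (bump 0 e x) y \<partial>lebesgue) = 0" if "cball x e \<subseteq> {x. u x > \<psi> x}"
    unfolding eq using g(3)[OF t] tsupport_bump[OF assms, of 0 x] that by auto
qed

lemma v_super: "weakly_superharmonic v S"
  using v_laplacian by (simp add: weakly_superharmonic_def)

lemma v_sub: "S \<subseteq> {x. u x > \<psi> x} \<Longrightarrow> weakly_superharmonic (\<lambda>x. - v x) S"
  unfolding weakly_superharmonic_def using v_laplacian(2) by (auto simp: subset_trans)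

lemma v_inf: "(v \<longlongrightarrow> 0) at_infinity"
proof -
  obtain B where B: "\<And>x. x \<in> D \<Longrightarrow> norm x \<le> B" using D(2) unfolding bounded_iff by blast
  have "eventually (\<lambda>x. q * u x = v x) at_infinity"
    unfolding eventually_at_infinity
  proof (intro exI[of _ "B + 1"] allI impI)
    fix x :: 'a assume "B + 1 \<le> norm x"
    then have "x \<notin> D" using B by force
    then show "q * u x = v x" by (simp add: v_out)
  qed
  moreover have "((\<lambda>x. q * u x) \<longlongrightarrow> q * 0) at_infinity" by (intro tendsto_intros u_inf)
  ultimately show ?thesis using Lim_transform_eventually by fastforce
qed

lemma v_frontier: "x \<in> frontier D \<Longrightarrow> v x = q * d"
  using frontier_notin v_out u_bdry by simp

text \<open>Minimum principle in the bounded set \<open>D\<close>, where the condition at infinity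
  is vacuous.\<close>

lemma v_ge: "x \<in> D \<Longrightarrow> v x \<ge> q * d"
proof (rule comparison_const[OF D(1) v_lip v_super])
  show "\<exists>R. \<forall>x\<in>D. norm x > R \<longrightarrow> v x - q * d > - m" for m
    using D(2) unfolding bounded_iff by (meson not_le)
qed (auto simp: v_frontier)

lemma u_ge: "x \<in> D \<Longrightarrow> u x \<ge> d"
proof -
  assume "x \<in> D"
  then have "p * d \<le> p * u x" using v_ge v_in by (force simp: algebra_simps)
  then show ?thesis using pq by simp
qed

lemma fund_sol_antimono:
  assumes "0 < norm x" "norm x < norm y" "c > 0"
  shows "fund_sol c (y :: 'a) < fund_sol c (x :: 'a)"
proof -
  have "x \<bullet> x > 0" "x \<bullet> x < y \<bullet> y"
    using assms power_strict_mono[of "norm x" "norm y" 2] by (auto simp: power2_norm_eq_inner)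
  then have "(y \<bullet> y) powr ((2 - real DIM('a)) / 2) < (x \<bullet> x) powr ((2 - real DIM('a)) / 2)"
    using dim by (intro powr_less_mono2_neg) auto
  then show ?thesis using assms(3) by (simp add: fund_sol_def)
qed

text \<open>A positive multiple of the fundamental solution is a lower barrier for \<open>v\<close>
  in the exterior: it tends to zero as \<open>v\<close> does, and is small enough on the
  frontier.\<close>

lemma u_pos_outside:
  assumes "x \<notin> D"
  shows "u x > 0"
proof (cases "x \<in> frontier D")
  case True
  then show ?thesis using u_bdry d by simp
next
  case False
  define S where "S = - closure D"
  have x: "x \<in> S" using False assms closure_Un_frontier[of D] by (auto simp: S_def)
  have clS: "closure S \<subseteq> - D"
    unfolding S_def by (rule closure_minimal) (use closure_subset[of D] D(1) in auto)
  have frS: "frontier S \<subseteq> frontier D"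
    unfolding S_def frontier_complement using interior_mono[OF closure_subset[of D]] by (auto simp: frontier_def)
  obtain s where s: "s > 0" "ball 0 s \<subseteq> D" using D(1,3) openE by blast
  obtain b :: 'a where b: "b \<in> Basis" using nonempty_Basis by blast
  \<comment> \<open>A point closer to the origin than the whole frontier. Normalising the barrier to
    \<open>q * d\<close> at \<open>y\<close> keeps it below \<open>q * d\<close> on the frontier by
    radial monotonicity.\<close>
  define y where "y = (s / 2) *\<^sub>R b"
  have y: "norm y = s / 2" using b s by (simp add: y_def)
  define c where "c = q * d / fund_sol 1 y"
  have f1: "fund_sol 1 y > 0" using y s by (auto simp: fund_sol_def)
  have c: "c > 0" using f1 pq d by (simp add: c_def)
  have "fund_sol c x \<le> v x"
  proof (rule comparison_fund_sol[OF dim _ _ v_lip v_super _ v_inf x])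
    show "open S" unfolding S_def by (intro open_Compl closed_closure)
    show "0 \<notin> closure S" using clS D(3) by blast
    fix z assume "z \<in> frontier S"
    then have z: "z \<in> frontier D" using frS by blast
    then have "z \<notin> ball 0 s" using s(2) frontier_notin by blast
    then have "fund_sol c z < fund_sol c y" using y s c by (intro fund_sol_antimono) auto
    also have "fund_sol c y = q * d" using f1 by (simp add: c_def fund_sol_def)
    finally show "fund_sol c z \<le> v z" using v_frontier[OF z] by simp
  qed
  moreover have "x \<noteq> 0" using assms D(3) by blast
  then have "fund_sol c x > 0" using c by (simp add: fund_sol_def)
  ultimately have "q * u x > 0" unfolding v_out[OF assms] by linarith
  then show ?thesis using pq(2) by (simp add: zero_less_mult_iff)
qed

text \<open>Off \<open>D\<close> one has \<open>u > 0\<close> while the obstacle is at most 0. In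
  \<open>D\<close> the bound \<open>u \<ge> d > 0\<close> makes the obstacle positive at
  contact.\<close>

lemma contact:
  assumes "u x = \<psi> x"
  shows "x \<in> D" "\<psi> x > 0"
proof -
  show x: "x \<in> D" using u_pos_outside[of x] psi_supp[of x] assms by force
  show "\<psi> x > 0" using u_ge[OF x] d assms by simp
qed

text \<open>Hence where a rotated copy of \<open>v\<close> lies below \<open>v\<close>, there is no contact and \<open>v\<close> is harmonic.\<close>

lemma contact_radial_le:
  assumes "norm x = norm y" "u x = \<psi> x" 
  shows "y \<in> D" "v x \<le> v y"
proof -
  show y: "y \<in> D" using contact[OF assms(2)] psi_rad[OF assms(1)] psi_supp[of y] by simp
  have "u x \<le> u y" using psi_le[of y] psi_rad[OF assms(1)] assms(2) by simp
  \<comment> \<open>Both points lie in \<open>D\<close>, so the same increasing affine formula turns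
    \<open>u\<close> into \<open>v\<close>.\<close>
  then show "v x \<le> v y" using v_in[OF y] v_in[OF contact(1)[OF assms(2)]] pq(1) by simp
qed

text \<open>On \<open>S\<close> there is no contact, so \<open>- v\<close> is superharmonic there
  and so is \<open>w\<close>. As \<open>S\<close> is open, \<open>w \<ge> 0\<close> on its frontier,
  and \<open>w\<close> vanishes at infinity; comparison gives \<open>w \<ge> 0\<close> on
  \<open>S\<close>, which is therefore empty.\<close>

lemma v_le_orthogonal:
  assumes R: "orthogonal_transformation R"
  shows "v x \<le> v (R x)"
proof -
  define w where "w x = v (R x) - v x" for x
  define S where "S = {x. v (R x) < v x}"
  have nR: "norm (R x) = norm x" for x using orthogonal_transformation_norm[OF R] .
  have dR: "dist (R a) (R b) = dist a b" for a b
    using R by (metis dist_norm linear_diff orthogonal_transformation_linear orthogonal_transformation_norm)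
  have vR: "K-lipschitz_on UNIV (\<lambda>x. v (R x))"
    using lipschitz_onD[OF v_lip] lipschitz_on_nonneg[OF v_lip] dR by (intro lipschitz_onI) (metis UNIV_I)+
  have w_lip: "(K + K)-lipschitz_on UNIV w"
    unfolding w_def[abs_def] by (intro lipschitz_on_diff vR v_lip)
  have "open S" unfolding S_def
    by (intro open_Collect_less lipschitz_on_continuous_on[OF vR] v_cont)
  have Ssub: "S \<subseteq> {x. u x > \<psi> x}"
  proof
    fix x assume "x \<in> S"
    then have "u x \<noteq> \<psi> x" using contact_radial_le(2)[of x "R x"] nR by (auto simp: S_def)
    then show "x \<in> {x. u x > \<psi> x}" using psi_le[of x] by simp
  qed
  have "weakly_superharmonic w S" unfolding weakly_superharmonic_def
  proof (intro allI impI)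
    fix x e assume e: "0 < e \<and> cball x e \<subseteq> S"
    have c: "continuous_on UNIV (laplacian (bump 0 e x))" using e by (intro test_fun_laplacian test_fun_bump) simp
    have nz: "norm y \<le> norm x + e" if "laplacian (bump 0 e x) y \<noteq> 0" for y
    proof -
      have "dist x y < e" 
        using that bump_support[of e] e unfolding laplacian_bump by (metis diff_0_right mult_zero_left mult_zero_right diff_self)
      then show ?thesis using norm_triangle_sub[of y x] by (simp add: dist_norm norm_minus_commute)
    qed
    have i: "integrable lebesgue (\<lambda>y. f y * laplacian (bump 0 e x) y)" if "continuous_on UNIV f" for f
      by (rule integrable_locally_integrable_mult[OF continuous_locally_integrable[OF that] c nz])
    have "(\<integral>y. w y * laplacian (bump 0 e x) y \<partial>lebesgue) = (\<integral>y. v (R y) * laplacian (bump 0 e x) y \<partial>lebesgue) - (\<integral>y. v y * laplacian (bump 0 e x) y \<partial>lebesgue)"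
      using i[OF v_cont] i[OF lipschitz_on_continuous_on[OF vR]] by (simp add: w_def left_diff_distrib)
    also have "(\<integral>y. v y * laplacian (bump 0 e x) y \<partial>lebesgue) = 0"
      using v_laplacian(2)[of e x] e Ssub by blast
    also have "(\<integral>y. v (R y) * laplacian (bump 0 e x) y \<partial>lebesgue) \<le> 0"
      using weakly_superharmonic_orthogonal[OF R v_super v_cont] e by (simp add: weakly_superharmonic_def)
    finally show "(\<integral>y. w y * laplacian (bump 0 e x) y \<partial>lebesgue) \<le> 0" by simp
  qed
  have "0 \<le> w x" if "x \<in> S" for x
  proof (rule comparison_const[OF \<open>open S\<close> w_lip \<open>weakly_superharmonic w S\<close> _ _ that])
    fix x assume "x \<in> frontier S"
    then have "x \<notin> S" using \<open>open S\<close> by (simp add: frontier_def interior_open)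
    then show "0 \<le> w x" by (simp add: S_def w_def)
  next
    fix m :: real assume "m > 0"
    then have "eventually (\<lambda>x. \<bar>v x\<bar> < m / 2) at_infinity"
      using tendstoD[OF v_inf, of "m / 2"] by simp
    then obtain B where B: "\<And>x. norm x \<ge> B \<Longrightarrow> \<bar>v x\<bar> < m / 2" unfolding eventually_at_infinity by blast
    have "w x - 0 > - m" if "norm x > B" for x
      using B[of x] B[of "R x"] that nR[of x] unfolding w_def by linarith
    then show "\<exists>B. \<forall>x\<in>S. B < norm x \<longrightarrow> - m < w x - 0" by blast
  qed
  then show ?thesis by (cases "x \<in> S") (auto simp: S_def w_def)
qed

text \<open>One orthogonal map takes \<open>x\<close> to \<open>y\<close>, another takes
  \<open>y\<close> to \<open>x\<close>; each gives one inequality.\<close>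

lemma v_radial: "norm x = norm y \<Longrightarrow> v x = v y"
  by (metis exists_orthogonal_swap order_antisym v_le_orthogonal)

lemma contact_radial:
  assumes "norm x = norm y" "u x = \<psi> x"
  shows "u y = \<psi> y"
proof -
  have "p * u x = p * u y"
    using v_radial[OF assms(1)] v_in[OF contact(1)[OF assms(2)]] v_in[OF contact_radial_le(1)[OF assms]] by simp
  then show ?thesis using pq(1) assms(2) psi_rad[OF assms(1)] by simp
qed

text \<open>Minimum principle in the ball of radius \<open>norm y\<close>, on whose boundary
  \<open>v\<close> is constantly \<open>v y\<close> by radial symmetry.\<close>

lemma v_antimono:
  assumes "norm x \<le> norm y"
  shows "v y \<le> v x"
proof (cases "norm x = norm y")
  case True
  then show ?thesis using v_radial[of x y] by simp
next
  case False
  then have lt: "norm x < norm y" using assms by simp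
  have y: "norm y > 0" using lt norm_ge_zero[of x] by linarith
  show ?thesis
  proof (rule comparison_const[OF open_ball v_lip v_super])
    show "x \<in> ball 0 (norm y)" using lt by simp
    show "v y \<le> v z" if "z \<in> frontier (ball 0 (norm y))" for z
      using that y v_radial[of z y] by (simp add: frontier_ball)
    show "\<exists>R. \<forall>x\<in>ball 0 (norm y). norm x > R \<longrightarrow> v x - v y > - m" for m
      by (intro exI[of _ "norm y"]) auto
  qed
qed

lemma contact_compact: "compact {x. u x = \<psi> x}"
proof -
  have "closed {x. u x = \<psi> x}" by (intro closed_Collect_eq u_cont psi_cont)
  moreover have "bounded {x. u x = \<psi> x}" by (rule bounded_subset[OF D(2)]) (use contact in blast)
  ultimately show ?thesis by (simp add: compact_eq_bounded_closed)
qed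

lemma frontier_sphere:
  assumes a: "a \<in> frontier D" "\<And>x. x \<in> frontier D \<Longrightarrow> norm a \<le> norm x"
    and b: "b \<in> frontier D" "\<And>x. x \<in> frontier D \<Longrightarrow> norm x \<le> norm b"
  shows "norm a = norm b"
proof (rule ccontr)
  assume "norm a \<noteq> norm b"
  then have ab: "norm a < norm b" using a(2)[OF b(1)] by simp
  have a0: "norm a > 0" using frontier_notin[OF a(1)] D(3) by auto
  have lt: "norm x < norm b" if "u x = \<psi> x" for x
  proof -
    have "norm x \<le> norm b"
      by (rule outside_bounded_frontier[OF D(2) b(2) norm_ge_zero contact(1)[OF that]])
    \<comment> \<open>Contact at this radius would put \<open>b\<close> itself into \<open>D\<close>
      by symmetry of the obstacle, but \<open>b\<close> is a frontier point of an open set.\<close>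
    moreover have "norm x \<noteq> norm b"
      using contact_radial_le(1)[OF _ that] frontier_notin[OF b(1)] by blast
    ultimately show ?thesis by simp
  qed
  \<comment> \<open>A sphere enclosing all contact points yet inside the shell where
    \<open>v\<close> is constant. Compactness of the contact set gives the strict bound
    \<open>r < norm b\<close>; without contact \<open>norm a\<close> serves.\<close>
  obtain r where r: "norm a \<le> r" "r < norm b" "\<And>x. u x = \<psi> x \<Longrightarrow> norm x \<le> r"
  proof (cases "{x. u x = \<psi> x} = {}")
    case True
    then show ?thesis using that[of "norm a"] ab by auto
  next
    case False
    obtain c where c: "u c = \<psi> c" "\<And>x. u x = \<psi> x \<Longrightarrow> norm x \<le> norm c"
      using continuous_attains_sup[OF contact_compact False continuous_on_norm_id] by auto
    show ?thesis using that[of "max (norm a) (norm c)"] ab lt[OF c(1)] c(2) by (auto simp: le_max_iff_disj)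
  qed
  define S where "S = {x::'a. norm x > r}"
  have Sc: "S = - cball 0 r" by (auto simp: S_def)
  define z where "z = (r / norm b) *\<^sub>R b"
  have r0: "r > 0" using r(1) a0 by linarith
  have "norm b \<noteq> 0" using r0 r(2) by linarith
  then have z: "norm z = r" using r0 by (simp add: z_def)
  \<comment> \<open>Monotonicity squeezes \<open>v z\<close> between the values at \<open>a\<close>
    and \<open>b\<close>, both equal to \<open>q * d\<close>.\<close>
  have vz: "v z = q * d"
    using v_antimono[of a z] v_antimono[of z b] z r v_frontier a(1) b(1) by simp
  have frS: "norm x = r" if "x \<in> frontier S" for x
    using that r0 unfolding Sc frontier_complement by simp
  define c where "c = q * d / fund_sol 1 z"
  have f1: "fund_sol 1 z > 0" using z r0 by (auto simp: fund_sol_def)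
  have c: "c > 0" using f1 pq d by (simp add: c_def)
  \<comment> \<open>Beyond the sphere \<open>- v\<close> is superharmonic, so \<open>v\<close> lies
    below \<open>fund_sol c\<close>, normalised to \<open>q * d\<close> on the sphere. The barrier
    decreases strictly, which contradicts \<open>v b = q * d\<close>.\<close>
  have "fund_sol (- c) b \<le> - v b"
  proof (rule comparison_fund_sol[OF dim])
    show "open S" unfolding Sc by (intro open_Compl closed_cball)
    have "closure S \<subseteq> - ball 0 r" unfolding Sc by (rule closure_minimal) auto
    then show "0 \<notin> closure S" using r0 by auto
    show "K-lipschitz_on UNIV (\<lambda>x. - v x)" using v_lip by (rule lipschitz_on_minus)
    show "weakly_superharmonic (\<lambda>x. - v x) S"
    proof (rule v_sub, rule subsetI)
      fix x assume "x \<in> S"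
      then have "u x \<noteq> \<psi> x" using r(3)[of x] by (auto simp: S_def)
      then show "x \<in> {x. u x > \<psi> x}" using psi_le[of x] by simp
    qed
    show "((\<lambda>x. - v x) \<longlongrightarrow> 0) at_infinity" using tendsto_minus[OF v_inf] by simp
    show "b \<in> S" using r by (simp add: S_def)
    fix x assume "x \<in> frontier S"
    then have x: "norm x = norm z" using frS z by simp
    then have "x \<bullet> x = z \<bullet> z" by (metis power2_norm_eq_inner)
    then have "fund_sol (- c) x = - (c * fund_sol 1 z)" by (simp add: fund_sol_def)
    also have "\<dots> = - (q * d)" using f1 by (simp add: c_def)
    finally show "fund_sol (- c) x \<le> - v x" using v_radial[OF x] vz by simp
  qed
  then have "q * d \<le> fund_sol c b" using v_frontier[OF b(1)] by (simp add: fund_sol_def)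
  also have "\<dots> < fund_sol c z" using z r r0 c by (intro fund_sol_antimono) auto
  also have "\<dots> = q * d" using f1 by (simp add: c_def fund_sol_def)
  finally show False by simp
qed

lemma D_ball: obtains r where "r > 0" "D = ball 0 r"
proof -
  have fr: "compact (frontier D)" "frontier D \<noteq> {}"
    using D D_ne_UNIV by (auto simp: compact_frontier_bounded frontier_eq_empty)
  obtain a where a: "a \<in> frontier D" "\<And>x. x \<in> frontier D \<Longrightarrow> norm a \<le> norm x"
    using continuous_attains_inf[OF fr continuous_on_norm_id] by auto
  obtain b where b: "b \<in> frontier D" "\<And>x. x \<in> frontier D \<Longrightarrow> norm x \<le> norm b"
    using continuous_attains_sup[OF fr continuous_on_norm_id] by auto
  note ab = frontier_sphere[OF a b]
  have "norm a > 0" using frontier_notin[OF a(1)] D(3) by auto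
  moreover have "D = ball 0 (norm a)"
    by (rule spherical_frontier_imp_ball[OF D \<open>norm a > 0\<close>]) (use a b ab in force)
  ultimately show ?thesis by (rule that)
qed

text \<open>\<open>u\<close> is recovered from \<open>v\<close> by different formulas inside and
  outside \<open>D\<close>. Knowing that \<open>D\<close> is a ball puts both points on the same
  side.\<close>

lemma u_radial:
  assumes "norm x = norm y" shows "u x = u y"
proof -
  obtain r where "D = ball 0 r" using D_ball by blast
  then have "x \<in> D \<longleftrightarrow> y \<in> D" using assms by simp
  then show ?thesis
    using v_radial[OF assms] v_in[of x] v_in[of y] v_out[of x] v_out[of y] pq by (cases "x \<in> D") auto
qed

end

theorem theorem1p4:
  fixes D :: "'a::euclidean_space set"
    and \<alpha> \<sigma>p \<sigma>m d :: real
    and \<psi> u :: "'a \<Rightarrow> real"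
  assumes dim: "DIM('a) \<ge> 3"
    and domain: "open D" "connected D" "bounded D" "0 \<in> D"
    and alpha: "0 < \<alpha>" "\<alpha> < 1"
    and bdry: "C2alpha_boundary D \<alpha>"
    and sig: "\<sigma>p > 0" "\<sigma>m > 0" "\<sigma>p \<noteq> \<sigma>m"
    and psi_reg: "C2_closure D \<psi>" "continuous_on UNIV \<psi>"
    and psi_pos: "\<exists>x. \<psi> x > 0"
    and psi_rad: "\<forall>x y. norm x = norm y \<longrightarrow> \<psi> x = \<psi> y"
    and psi_supp: "closure {x. \<psi> x > 0} \<subseteq> D"
    and u_reg: "C11_closure D u" "\<exists>L. L-lipschitz_on UNIV u"
    and u_sol: "obstacle_solution (\<lambda>x. if x \<in> D then \<sigma>p else \<sigma>m) \<psi> u"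
    and u_inf: "(u \<longlongrightarrow> 0) at_infinity"
    and u_bdry: "d > 0" "\<forall>x\<in>frontier D. u x = d"
  shows "(\<forall>x y. norm x = norm y \<longrightarrow> u x = u y) \<and> (\<exists>r>0. D = ball 0 r)"
proof -
  obtain L where L: "L-lipschitz_on UNIV u" using u_reg(2) by blast
  have supp: "x \<in> D" if "\<psi> x > 0" for x
    using psi_supp closure_subset[of "{x. \<psi> x > 0}"] that by blast
  interpret overdetermined_obstacle D \<sigma>p \<sigma>m d L \<psi> u
    "\<lambda>x. \<sigma>m * u x + (\<sigma>p - \<sigma>m) * (indicator D x * (u x - d))"
    by unfold_locales (use assms L supp in blast)+
  show ?thesis using u_radial D_ball by metis
qed

end
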